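(* Let $\{f_n\}$ be a sequence of additive arithmetic functions. Put $A_n=\sum_{p\le n}f_n(p)/p$ and $B_n^2=\sum_{p\le n}f_n(p)^2/p$ ($p$ prime). Assume there is $n_0$ with $A_n\ne0$ and $B_n>0$ for $n\ge n_0$. Assume that, as $n\to\infty$: $f_n(m)/B_n\to0$ for every $m\in\mathbb{N}$, $\max_{p\le n}|f_n(p)|/B_n\to0$, and $|A_n|/B_n\to\infty$. Let $\delta>0$. Let $g$ be differentiable on $[1-\delta,1+\delta]$ with $g'(1)\ne0$. Let $\{g_n\}$ be functions differentiable on $[1-\delta,1+\delta]$ with $g_n'\to g'$ uniformly on $[1-\delta,1+\delta]$ and $g_n(1)\to g(1)$. Then $$\frac{g_n(f_n/A_n)-g_n(1)}{g_n'(1)(B_n/A_n)}\Rightarrow\Phi.$$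
   Context: An arithmetic function $f$ is additive if $f(m_1m_2)=f(m_1)+f(m_2)$ for coprime positive integers $m_1,m_2$. $\Phi$ is the standard normal distribution function. $\mathbb{P}_n$ is the uniform probability measure on $\{1,\dots,n\}$. For functions $h_n$ defined on sets $\mathbb{M}_n\subseteq\{1,\dots,n\}$ (for $n$ large) with $\mathbb{P}_n(\mathbb{M}_n)\to1$, $h_n\Rightarrow\Phi$ means $\mathbb{P}_n(\{m\in\mathbb{M}_n:h_n(m)\le x\})\to\Phi(x)$ for all $x\in\mathbb{R}$. Here $\mathbb{M}_n$ is the set of $m\in\{n_0,\dots,n\}$ with $f_n(m)/A_n\in[1-\delta,1+\delta]$, where the expression is defined. *)

theory Defs
  imports "HOL-Probability.Probability"
begin

definition additive_arith :: "(nat \<Rightarrow> real) \<Rightarrow> bool" where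
  "additive_arith f \<longleftrightarrow>
     (\<forall>m1 m2. 0 < m1 \<longrightarrow> 0 < m2 \<longrightarrow> coprime m1 m2 \<longrightarrow> f (m1 * m2) = f m1 + f m2)"

definition primes_upto :: "nat \<Rightarrow> nat set" where
  "primes_upto n = {p. prime p \<and> p \<le> n}"

definition mean_A :: "(nat \<Rightarrow> nat \<Rightarrow> real) \<Rightarrow> nat \<Rightarrow> real" where
  "mean_A f n = (\<Sum>p\<in>primes_upto n. f n p / real p)"

definition dev_B :: "(nat \<Rightarrow> nat \<Rightarrow> real) \<Rightarrow> nat \<Rightarrow> real" where
  "dev_B f n = sqrt (\<Sum>p\<in>primes_upto n. (f n p)\<^sup>2 / real p)"

definition unif_prob :: "nat \<Rightarrow> nat set \<Rightarrow> real" where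
  "unif_prob n S = measure_pmf.prob (pmf_of_set {1..n}) S"

definition Phi :: "real \<Rightarrow> real" where
  "Phi = cdf std_normal_distribution"

text \<open>The functions \<open>h n\<close> matter only on the sets \<open>M n\<close>. That \<open>M n\<close> has asymptotically
  full probability is what makes the notion meaningful, so it is part of the definition.\<close>

definition conv_Phi :: "(nat \<Rightarrow> nat set) \<Rightarrow> (nat \<Rightarrow> nat \<Rightarrow> real) \<Rightarrow> bool" where
  "conv_Phi M h \<longleftrightarrow>
     (\<forall>\<^sub>F n in sequentially. M n \<subseteq> {1..n}) \<and>
     (\<lambda>n. unif_prob n (M n)) \<longlonglongrightarrow> 1 \<and>
     (\<forall>x. (\<lambda>n. unif_prob n {m \<in> M n. h n m \<le> x}) \<longlonglongrightarrow> Phi x)"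

text \<open>If \<open>mean_A f n \<noteq> 0\<close> for all \<open>n \<ge> n0\<close>, then \<open>n0 \<ge> 2\<close>, since \<open>mean_A f 0 = mean_A f 1 = 0\<close>; so
  this set then lies in \<open>{1..n}\<close>.\<close>

definition dom_set :: "(nat \<Rightarrow> nat \<Rightarrow> real) \<Rightarrow> nat \<Rightarrow> real \<Rightarrow> nat \<Rightarrow> nat set" where
  "dom_set f n0 \<delta> n = {m \<in> {n0..n}. f n m / mean_A f n \<in> {1 - \<delta>..1 + \<delta>}}"

end

theory Submission imports Defs "HOL-Real_Asymp.Real_Asymp" begin

text \<open>
  The core is a central limit theorem for \<open>(f n - A n) / B n\<close> under the uniform measure. Put
  \<open>a p = f n p / B n\<close>. Since \<open>max \<bar>a p\<bar>\<close> tends to \<open>0\<close> and the sum of \<open>1 / p\<close> over \<open>n\<^sup>1\<^sup>/\<^sup>r < p \<le> n\<close> is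
  bounded in terms of \<open>r\<close> (Chebyshev, via central binomial coefficients), the primes beyond \<open>n\<^sup>1\<^sup>/\<^sup>r\<close>
  contribute little in mean. For the remaining primes the indicators \<open>p dvd m\<close> are compared with
  independent events of probability \<open>1 / p\<close>: every joint probability agrees up to \<open>1 / n\<close>, hence so do
  the moments of the centred sums up to a factor \<open>(2 y) ^ k\<close>, and a Taylor expansion of order \<open>r\<close>
  compares the characteristic functions. In the model the exponential moments are bounded, so the
  Taylor remainder decays like \<open>2 ^ (- r)\<close>, and the characteristic function is a product close to
  the normal one. Higher prime powers are negligible outside a set of small density, and Levy's
  continuity theorem applies. Finally \<open>gn n\<close> is linearized at \<open>1\<close>.\<close>

subsection \<open>Primes in dyadic blocks\<close>

text \<open>Joint divisibility probabilities are known only up to 1 / n, and a moment of order r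
  over primes up to y multiplies this error by up to (2 y)^r. So y must stay below a small power of
  n, the smaller the larger r is; with y^(2 r) \<le> n the error is of order 1 / sqrt n. A fixed r,
  on the other hand, leaves a Taylor remainder that does not vanish with n. The limit is therefore
  taken in two stages: r is chosen from the target accuracy, then n grows. This works because
  whatever deteriorates with r (the mass of 1 / p above the cut-off, the variance missing there, the
  factor 2^r) is multiplied by max |a p| or by 1 / sqrt n, and both tend to 0 while r is fixed. For
  the same reason a Chebyshev bound suffices: the mass above the cut-off need only be bounded, not
  known asymptotically.\<close>

lemma prod_distinct_primes_dvd_iff:
  fixes m :: nat
  assumes "finite D" "\<And>p. p \<in> D \<Longrightarrow> prime p"
  shows "\<Prod>D dvd m \<longleftrightarrow> (\<forall>p\<in>D. p dvd m)"
  using assms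
proof (induction D rule: finite_induct)
  case (insert p D)
  have "coprime p (\<Prod>D)"
    using insert by (intro prod_coprime_right) (metis insertI1 insertI2 primes_coprime)
  then have "p * \<Prod>D dvd m \<longleftrightarrow> p dvd m \<and> \<Prod>D dvd m"
    by (meson divides_mult dvd_mult_left dvd_mult_right)
  with insert show ?case by simp
qed simp

lemma finite_primes_upto [simp]: "finite (primes_upto n)"
  by (rule finite_subset[of _ "{..n}"]) (auto simp: primes_upto_def)

text \<open>Let N = 2^i. A prime in (N, 2 N] divides (2 N)! but not N!, so it divides the central
  binomial coefficient, which is at most 2^(2 N). The product of these primes is at least N to the
  power of their number, and comparing exponents of 2 gives the count.\<close>

lemma dyadic_prime_count:
  "real i * card {p::nat. prime p \<and> 2 ^ i < p \<and> p \<le> 2 ^ Suc i} \<le> 2 * 2 ^ i"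
proof -
  let ?N = "2 ^ i :: nat" and ?P = "{p::nat. prime p \<and> 2 ^ i < p \<and> p \<le> 2 ^ Suc i}"
  have fin: "finite ?P" by (rule finite_subset[of _ "{..2 ^ Suc i}"]) auto
  have "\<Prod>?P dvd (2 * ?N choose ?N)"
  proof (subst prod_distinct_primes_dvd_iff[OF fin]; safe)
    fix p :: nat assume p: "prime p" "2 ^ i < p" "p \<le> 2 ^ Suc i"
    have "fact ?N * fact ?N * (2 * ?N choose ?N) = (fact (2 * ?N) :: nat)"
      using binomial_fact_lemma[of ?N "2 * ?N"] by simp
    moreover have "p dvd fact (2 * ?N)" using p by (simp add: prime_dvd_fact_iff)
    moreover have "\<not> p dvd fact ?N" using p by (simp add: prime_dvd_fact_iff)
    ultimately show "p dvd (2 * ?N choose ?N)" using p(1)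
      by (metis prime_dvd_mult_iff)
  qed
  then have "\<Prod>?P \<le> (2 * ?N choose ?N)" by (rule dvd_imp_le) simp
  also have "\<dots> \<le> 2 ^ (2 * ?N)" by (rule binomial_le_pow2)
  finally have "\<Prod>?P \<le> 2 ^ (2 * ?N)" .
  moreover have "?N ^ card ?P \<le> \<Prod>?P"
    using prod_mono[of ?P "\<lambda>_. ?N" "\<lambda>p. p"] by (simp add: less_imp_le)
  ultimately have "(2::nat) ^ (i * card ?P) \<le> 2 ^ (2 * ?N)"
    by (simp add: power_mult)
  then have "i * card ?P \<le> 2 * ?N" by simp
  then have "real (i * card ?P) \<le> real (2 * ?N)" by (rule of_nat_mono)
  then show ?thesis by simp
qed

text \<open>The block from 2^j to 2^(j + 1) has at most 2 * 2^j / j primes, each with reciprocal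
  below 2^(-j), so it contributes at most 2 / j \<le> 2 / i. The bound is linear in k, weaker than
  the logarithm in Mertens' theorem, but enough while k / i stays bounded.\<close>

lemma sum_inverse_primes_dyadic:
  "(\<Sum>p | prime p \<and> (2::nat) ^ i < p \<and> p \<le> 2 ^ (i + k). 1 / real p) \<le> 2 * real k / real i"
  if "i > 0"
proof (induction k)
  case (Suc k)
  let ?A = "{p. prime p \<and> (2::nat) ^ i < p \<and> p \<le> 2 ^ (i + k)}"
  let ?B = "{p. prime p \<and> (2::nat) ^ (i + k) < p \<and> p \<le> 2 ^ Suc (i + k)}"
  have le: "(2::nat) ^ i \<le> 2 ^ (i + k)" "(2::nat) ^ (i + k) \<le> 2 ^ (i + Suc k)" by simp_all
  have eq: "{p. prime p \<and> (2::nat) ^ i < p \<and> p \<le> 2 ^ (i + Suc k)} = ?A \<union> ?B"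
  proof -
    have "{p. prime p \<and> a < p \<and> p \<le> c} = {p. prime p \<and> a < p \<and> p \<le> b} \<union> {p. prime p \<and> b < p \<and> p \<le> c}"
      if "a \<le> b" "b \<le> c" for a b c :: nat using that by auto
    from this[OF le] show ?thesis by simp
  qed
  have fin: "finite ?A" "finite ?B"
    by (rule finite_subset[of _ "{..2 ^ (i + k)}"]; auto)
       (rule finite_subset[of _ "{..2 ^ Suc (i + k)}"]; auto)
  have "(\<Sum>p\<in>?B. 1 / real p) \<le> (\<Sum>p\<in>?B. 1 / 2 ^ (i + k))"
  proof (intro sum_mono divide_left_mono)
    fix p assume "p \<in> ?B"
    then have "2 ^ (i + k) \<le> p" by simp
    then have "real (2 ^ (i + k)) \<le> real p" by (rule of_nat_mono)
    then show "2 ^ (i + k) \<le> real p" by simp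
    show "0 < real p * 2 ^ (i + k)" using \<open>p \<in> ?B\<close> by (auto simp: prime_gt_0_nat)
  qed auto
  also have "\<dots> = real (card ?B) / 2 ^ (i + k)" by simp
  also have "\<dots> \<le> 2 / real (i + k)"
    using dyadic_prime_count[of "i + k"] that by (simp add: field_simps)
  also have "\<dots> \<le> 2 / real i" using that by (intro divide_left_mono) auto
  finally have "(\<Sum>p\<in>?B. 1 / real p) \<le> 2 / real i" .
  then have "(\<Sum>p\<in>?A. 1 / real p) + (\<Sum>p\<in>?B. 1 / real p) \<le> 2 * real k / real i + 2 / real i"
    using Suc.IH by (rule add_mono[rotated])
  also have "\<dots> = 2 * real (Suc k) / real i" by (simp add: add_divide_distrib[symmetric])
  finally show ?case
    unfolding eq by (subst sum.union_disjoint) (use fin in auto)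
next
  case 0
  have "{p. prime p \<and> (2::nat) ^ i < p \<and> p \<le> 2 ^ (i + 0)} = {}" by auto
  then show ?case by (simp only: sum.empty)
qed

text \<open>The cut-off \<open>y\<close> is the largest power of two whose \<open>r\<close>-th power divides the largest power
  of two below \<open>n\<close>.\<close>

lemma exists_cutoff:
  fixes n r :: nat
  assumes "r > 0" "n \<ge> 2 ^ r"
  obtains y where "y ^ r \<le> n" "0 < y" "y \<le> n"
    "(\<Sum>p\<in>primes_upto n - primes_upto y. 1 / real p) \<le> 4 * real r"
proof -
  have "n > 0" using assms by (metis gr0I le_zero_eq power_not_zero zero_neq_numeral)
  obtain L where L: "2 ^ L \<le> n" "n < 2 ^ Suc L"
    using ex_power_ivl1[of 2 n] \<open>n > 0\<close> by auto
  define j where "j = L div r"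
  \<comment> \<open>Here n \<ge> 2^r enters: it makes j positive, so that the bound for the dyadic
    blocks applies.\<close>
  have "r \<le> L" using assms L(2)
    by (metis less_Suc_eq_le order_le_less_trans power_less_imp_less_exp one_less_numeral_iff semiring_norm(76))
  then have "j > 0" using assms by (simp add: j_def div_greater_zero_iff)
  have jr: "j * r \<le> L" "L < Suc j * r" using assms
    by (auto simp: j_def mult.commute[of _ r] dividend_less_times_div)
  show ?thesis
  proof (rule that[of "2 ^ j"])
    have "(2 ^ j) ^ r = (2::nat) ^ (j * r)" by (simp add: power_mult)
    also have "\<dots> \<le> 2 ^ L" using jr by (intro power_increasing) auto
    finally show le: "(2 ^ j) ^ r \<le> n" using L by simp
    show "0 < (2 ^ j :: nat)" by simp
    have "(2 ^ j :: nat) \<le> (2 ^ j) ^ r" using assms by (intro self_le_power) auto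
    with le show "(2 ^ j :: nat) \<le> n" by simp
    have "(\<Sum>p\<in>primes_upto n - primes_upto (2 ^ j). 1 / real p)
        \<le> (\<Sum>p | prime p \<and> (2::nat) ^ j < p \<and> p \<le> 2 ^ (j + (Suc L - j)). 1 / real p)"
    proof (rule sum_mono2)
      have "j \<le> L" using j_def by simp
      then show "primes_upto n - primes_upto (2 ^ j)
          \<subseteq> {p. prime p \<and> (2::nat) ^ j < p \<and> p \<le> 2 ^ (j + (Suc L - j))}"
        using L(2) by (auto simp: primes_upto_def)
    qed (auto intro: finite_subset[of _ "{..2 ^ (j + (Suc L - j))}"])
    also have "\<dots> \<le> 2 * real (Suc L - j) / real j"
      by (rule sum_inverse_primes_dyadic) fact
    \<comment> \<open>L < (j + 1) r bounds the number of blocks by (j + 1) r \<le> 2 j r; division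
      by j leaves 4 r, independent of n.\<close>
    also have "\<dots> \<le> 2 * real (2 * j * r) / real j"
    proof -
      have "Suc L - j \<le> Suc j * r" using jr by simp
      also have "\<dots> \<le> 2 * j * r" using \<open>j > 0\<close> by simp
      finally have "real (Suc L - j) \<le> real (2 * j * r)" by (rule of_nat_mono)
      then show ?thesis by (intro divide_right_mono) auto
    qed
    also have "\<dots> = 4 * real r" using \<open>j > 0\<close> by simp
    finally show "(\<Sum>p\<in>primes_upto n - primes_upto (2 ^ j). 1 / real p) \<le> 4 * real r" .
  qed
qed

section \<open>Sums of inverse squares and densities of multiples\<close>

lemma sum_inverse_squares_le:
  "(\<Sum>k\<in>{a<..b}. 1 / (real k)\<^sup>2) \<le> 1 / real a" if "a > 0"
proof (cases "a \<le> b")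
  case True
  \<comment> \<open>The term - 1 / b, dropped at the end, makes the induction telescope.\<close>
  then have "(\<Sum>k\<in>{a<..b}. 1 / (real k)\<^sup>2) \<le> 1 / real a - 1 / real b"
  proof (induction b rule: dec_induct)
    case (step b)
    have "{a<..Suc b} = insert (Suc b) {a<..b}" using step by auto
    moreover have "1 / (real (Suc b))\<^sup>2 \<le> 1 / real b - 1 / real (Suc b)"
    proof -
      have "b > 0" using that step by simp
      then have "1 / real b - 1 / real (Suc b) = 1 / (real b * real (Suc b))"
        by (simp add: field_simps)
      also have "\<dots> \<ge> 1 / (real (Suc b))\<^sup>2" using \<open>b > 0\<close>
        unfolding power2_eq_square by (intro divide_left_mono mult_right_mono) auto
      finally show ?thesis .
    qed
    ultimately show ?case using step by simp
  qed simp
  then show ?thesis by (smt (verit) divide_nonneg_nonneg of_nat_0_le_iff)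
qed simp

lemma sum_inverse_squares_primes_le:
  "(\<Sum>p\<in>primes_upto n. 1 / (real p)\<^sup>2) \<le> 1"
proof -
  have "(\<Sum>p\<in>primes_upto n. 1 / (real p)\<^sup>2) \<le> (\<Sum>p\<in>{1<..n}. 1 / (real p)\<^sup>2)"
    by (rule sum_mono2) (auto simp: primes_upto_def dest: prime_gt_1_nat simp del: One_nat_def)
  also have "\<dots> \<le> 1" using sum_inverse_squares_le[of 1 n] by simp
  finally show ?thesis .
qed

lemma card_multiples: "card {m\<in>{1..n}. d dvd m} = n div d" if "d > 0" for d n :: nat
proof -
  have "{m\<in>{1..n}. d dvd m} = (*) d ` {1..n div d}"
  proof (intro equalityI subsetI)
    fix m assume "m \<in> {m\<in>{1..n}. d dvd m}"
    then obtain k where "m = d * k" "1 \<le> m" "m \<le> n" by auto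
    then have "k \<in> {1..n div d}" using that
      by (auto simp: less_eq_div_iff_mult_less_eq mult.commute Suc_le_eq)
    with \<open>m = d * k\<close> show "m \<in> (*) d ` {1..n div d}" by blast
  next
    fix m assume "m \<in> (*) d ` {1..n div d}"
    then show "m \<in> {m\<in>{1..n}. d dvd m}" using that
      by (auto simp: less_eq_div_iff_mult_less_eq mult.commute Suc_le_eq)
  qed
  then show ?thesis using that by (simp add: card_image inj_on_def)
qed

text \<open>The first bound, with no additive error, is for sums over up to n divisors d, where an
  error of 1 / n in each term would be too much. The second is for comparing a single joint
  probability with the model.\<close>

lemma density_multiples:
  fixes d n :: nat
  assumes "d > 0" "n > 0"
  shows "card {m\<in>{1..n}. d dvd m} / n \<le> 1 / d"
    and "\<bar>card {m\<in>{1..n}. d dvd m} / n - 1 / d\<bar> \<le> 1 / n"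
proof -
  have 1: "real (n div d) \<le> real n / real d" by (rule of_nat_div_le_of_nat)
  have 2: "real n / real d - real (n div d) \<le> 1"
  proof -
    have "n \<le> d * (n div d) + d" using assms mod_less_divisor[of d n]
      by (metis add_le_cancel_left less_imp_le mult_div_mod_eq)
    then have "real n \<le> real (d * (n div d) + d)" by (rule of_nat_mono)
    then show ?thesis using assms by (simp add: field_simps)
  qed
  have 3: "card {m\<in>{1..n}. d dvd m} = n div d" using card_multiples assms by auto
  show "card {m\<in>{1..n}. d dvd m} / n \<le> 1 / d"
    unfolding 3 using assms 1 by (simp add: field_simps)
  show "\<bar>card {m\<in>{1..n}. d dvd m} / n - 1 / d\<bar> \<le> 1 / n"
  proof -
    have "real (n div d) / n - 1 / d = (n div d - real n / d) / n" using assms by (simp add: field_simps)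
    then have "\<bar>real (n div d) / n - 1 / d\<bar> = \<bar>n div d - real n / d\<bar> / n" by simp
    also have "\<dots> \<le> 1 / n" using 1 2 by (intro divide_right_mono) auto
    finally show ?thesis unfolding 3 .
  qed
qed

subsection \<open>The independent model\<close>

text \<open>The law of a random subset of \<open>P\<close> that contains each \<open>p\<close> independently with probability \<open>q p\<close>;
  averages over it are written as finite sums over \<open>Pow P\<close>.\<close>

definition model_weight :: "('b \<Rightarrow> real) \<Rightarrow> 'b set \<Rightarrow> 'b set \<Rightarrow> real" where
  "model_weight q P E = (\<Prod>p\<in>E. q p) * (\<Prod>p\<in>P - E. 1 - q p)"

definition centred_sum :: "('b \<Rightarrow> real) \<Rightarrow> ('b \<Rightarrow> real) \<Rightarrow> 'b set \<Rightarrow> 'b set \<Rightarrow> real" where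
  "centred_sum a q P E = (\<Sum>p\<in>P. a p * (of_bool (p \<in> E) - q p))"

lemma model_weight_nonneg:
  "(\<And>p. p \<in> P \<Longrightarrow> 0 \<le> q p \<and> q p \<le> 1) \<Longrightarrow> E \<subseteq> P \<Longrightarrow> 0 \<le> model_weight q P E"
  unfolding model_weight_def by (intro mult_nonneg_nonneg prod_nonneg) auto

text \<open>Independence: the sum over \<open>Pow P\<close> is the expansion of a product of
  two-term sums. The codomain of \<open>h\<close> is generic because real exponentials, indicators
  and complex characters are all averaged this way.\<close>

lemma model_average_prod:
  fixes h :: "'b \<Rightarrow> bool \<Rightarrow> 'a::{comm_ring_1, real_algebra_1}"
  assumes "finite P"
  shows "(\<Sum>E\<in>Pow P. of_real (model_weight q P E) * (\<Prod>p\<in>P. h p (p \<in> E))) =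
    (\<Prod>p\<in>P. of_real (q p) * h p True + of_real (1 - q p) * h p False)"
proof -
  have "of_real (model_weight q P E) * (\<Prod>p\<in>P. h p (p \<in> E)) =
      (\<Prod>p\<in>E. of_real (q p) * h p True) * (\<Prod>p\<in>P - E. of_real (1 - q p) * h p False)"
    if "E \<in> Pow P" for E
  proof -
    have "(\<Prod>p\<in>P. h p (p \<in> E)) = (\<Prod>p\<in>P - E. h p (p \<in> E)) * (\<Prod>p\<in>E. h p (p \<in> E))"
      using that assms by (intro prod.subset_diff) auto
    then show ?thesis
      by (simp add: model_weight_def prod.distrib algebra_simps del: of_real_diff)
  qed
  then show ?thesis using assms by (subst prod_add) auto
qed

text \<open>\<open>l\<close> stands for the difference of two laws, of which only the probabilities
  of the events \<open>D \<subseteq> E\<close> are compared. Expanding one factor of the power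
  either adds p to \<open>D\<close> or produces a factor q p, at total cost |a p| (1 + q p).
  \<open>D\<close> is kept general because the induction on \<open>k\<close> enlarges it.\<close>

lemma signed_moment_bound:
  fixes P :: "'b set" and l :: "'b set \<Rightarrow> real"
  assumes "finite P" and q: "\<And>p. p \<in> P \<Longrightarrow> 0 \<le> q p"
    and l: "\<And>D. D \<subseteq> P \<Longrightarrow> \<bar>\<Sum>E\<in>Pow P. l E * of_bool (D \<subseteq> E)\<bar> \<le> \<eta>"
    and "D \<subseteq> P"
  shows "\<bar>\<Sum>E\<in>Pow P. l E * (of_bool (D \<subseteq> E) * centred_sum a q P E ^ k)\<bar>
    \<le> \<eta> * (\<Sum>p\<in>P. \<bar>a p\<bar> * (1 + q p)) ^ k"
  using \<open>D \<subseteq> P\<close>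
proof (induction k arbitrary: D)
  case (Suc k)
  let ?S = "centred_sum a q P" and ?M = "\<Sum>p\<in>P. \<bar>a p\<bar> * (1 + q p)"
  define T where "T D = (\<Sum>E\<in>Pow P. l E * (of_bool (D \<subseteq> E) * ?S E ^ k))" for D
  have T: "\<bar>T D\<bar> \<le> \<eta> * ?M ^ k" if "D \<subseteq> P" for D
    unfolding T_def using Suc.IH that by simp
  have "(\<Sum>E\<in>Pow P. l E * (of_bool (D \<subseteq> E) * ?S E ^ Suc k)) =
      (\<Sum>E\<in>Pow P. \<Sum>p\<in>P. a p * (l E * (of_bool (insert p D \<subseteq> E) * ?S E ^ k)
        - q p * (l E * (of_bool (D \<subseteq> E) * ?S E ^ k))))"
  proof (rule sum.cong[OF refl])
    fix E assume "E \<in> Pow P"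
    have "l E * (of_bool (D \<subseteq> E) * ?S E ^ Suc k) = ?S E * (l E * (of_bool (D \<subseteq> E) * ?S E ^ k))"
      by simp
    also have "\<dots> = (\<Sum>p\<in>P. a p * (of_bool (p \<in> E) - q p) * (l E * (of_bool (D \<subseteq> E) * ?S E ^ k)))"
      by (subst centred_sum_def) (rule sum_distrib_right)
    also have "\<dots> = (\<Sum>p\<in>P. a p * (l E * (of_bool (insert p D \<subseteq> E) * ?S E ^ k)
        - q p * (l E * (of_bool (D \<subseteq> E) * ?S E ^ k))))"
      by (intro sum.cong refl) (auto simp: algebra_simps)
    finally show "l E * (of_bool (D \<subseteq> E) * ?S E ^ Suc k) = \<dots>" .
  qed
  also have "\<dots> = (\<Sum>p\<in>P. \<Sum>E\<in>Pow P. a p * (l E * (of_bool (insert p D \<subseteq> E) * ?S E ^ k)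
        - q p * (l E * (of_bool (D \<subseteq> E) * ?S E ^ k))))"
    by (rule sum.swap)
  also have "\<dots> = (\<Sum>p\<in>P. a p * (T (insert p D) - q p * T D))"
    unfolding T_def by (simp only: sum_distrib_left[symmetric] sum_subtractf)
  also have "\<bar>\<dots>\<bar> \<le> (\<Sum>p\<in>P. \<bar>a p\<bar> * (1 + q p) * (\<eta> * ?M ^ k))"
  proof (rule order_trans[OF sum_abs], rule sum_mono)
    fix p assume p: "p \<in> P"
    have "\<bar>T (insert p D) - q p * T D\<bar> \<le> \<bar>T (insert p D)\<bar> + q p * \<bar>T D\<bar>"
      using q[OF p] abs_triangle_ineq4[of "T (insert p D)" "q p * T D"] by (simp add: abs_mult)
    also have "\<dots> \<le> \<eta> * ?M ^ k + q p * (\<eta> * ?M ^ k)"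
      using T Suc.prems p q[OF p] by (intro add_mono mult_left_mono) auto
    finally have "\<bar>a p\<bar> * \<bar>T (insert p D) - q p * T D\<bar> \<le> \<bar>a p\<bar> * (\<eta> * ?M ^ k + q p * (\<eta> * ?M ^ k))"
      by (intro mult_left_mono) auto
    then show "\<bar>a p * (T (insert p D) - q p * T D)\<bar> \<le> \<bar>a p\<bar> * (1 + q p) * (\<eta> * ?M ^ k)"
      by (simp only: abs_mult) (simp add: distrib_left distrib_right mult_ac)
  qed
  also have "\<dots> = \<eta> * ?M ^ Suc k"
    unfolding sum_distrib_right[symmetric] power_Suc by (simp only: mult_ac)
  finally show ?case .
qed (use l in simp)

text \<open>Since \<open>r\<close> is even, the \<open>r\<close>-th absolute moment under \<open>u\<close> is the one under \<open>v\<close> plus a signed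
  moment, so the Taylor remainder needs no separate bound for \<open>u\<close>.\<close>

lemma char_difference_bound:
  fixes u v x :: "'i \<Rightarrow> real"
  assumes u: "\<And>i. i \<in> I \<Longrightarrow> 0 \<le> u i" and v: "\<And>i. i \<in> I \<Longrightarrow> 0 \<le> v i"
    and mom: "\<And>k. \<bar>\<Sum>i\<in>I. (u i - v i) * x i ^ k\<bar> \<le> \<eta> * M ^ k"
    and "1 \<le> M" "0 \<le> \<eta>" "even r" "0 < r"
  shows "cmod ((\<Sum>i\<in>I. u i *\<^sub>R iexp (t * x i)) - (\<Sum>i\<in>I. v i *\<^sub>R iexp (t * x i)))
    \<le> \<eta> * M ^ r * exp \<bar>t\<bar>
      + 2 * (\<Sum>i\<in>I. v i * (\<bar>t * x i\<bar> ^ r / fact r))"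
proof -
  \<comment> \<open>The Taylor polynomial has degree r - 1, so that its remainder has the even order
    r.\<close>
  let ?T = "\<lambda>i. \<Sum>k<r. (\<i> * complex_of_real (t * x i)) ^ k / fact k"
  have approx: "cmod (iexp (t * x i) - ?T i) \<le> \<bar>t * x i\<bar> ^ r / fact r" for i
  proof -
    obtain n where "r = Suc n" using \<open>0 < r\<close> gr0_conv_Suc by blast
    then show ?thesis using iexp_approx1[of "t * x i" n] by (simp only: lessThan_Suc_atMost)
  qed
  have even: "\<bar>z\<bar> ^ r = z ^ r" for z :: real using \<open>even r\<close> by (rule power_even_abs)
  have "(\<Sum>i\<in>I. u i *\<^sub>R iexp (t * x i)) - (\<Sum>i\<in>I. v i *\<^sub>R iexp (t * x i))
      = (\<Sum>i\<in>I. (u i - v i) *\<^sub>R iexp (t * x i))"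
    by (simp only: sum_subtractf scaleR_diff_left)
  also have "\<dots> = (\<Sum>i\<in>I. (u i - v i) *\<^sub>R (iexp (t * x i) - ?T i)) + (\<Sum>i\<in>I. (u i - v i) *\<^sub>R ?T i)"
    unfolding sum.distrib[symmetric] scaleR_diff_right by (simp only: diff_add_cancel)
  finally have 1: "cmod ((\<Sum>i\<in>I. u i *\<^sub>R iexp (t * x i)) - (\<Sum>i\<in>I. v i *\<^sub>R iexp (t * x i)))
      \<le> cmod (\<Sum>i\<in>I. (u i - v i) *\<^sub>R (iexp (t * x i) - ?T i)) + cmod (\<Sum>i\<in>I. (u i - v i) *\<^sub>R ?T i)"
    by (simp only: norm_triangle_ineq)
  have "cmod (\<Sum>i\<in>I. (u i - v i) *\<^sub>R ?T i) \<le> (\<Sum>k<r. \<bar>t\<bar> ^ k / fact k * (\<eta> * M ^ r))"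
  proof -
    have "(\<Sum>i\<in>I. (u i - v i) *\<^sub>R ?T i) =
        (\<Sum>i\<in>I. \<Sum>k<r. (\<i> * t) ^ k / fact k * complex_of_real ((u i - v i) * x i ^ k))"
      unfolding scaleR_conv_of_real sum_distrib_left of_real_mult of_real_power power_mult_distrib
      by (intro sum.cong refl) (simp only: mult_ac times_divide_eq_left times_divide_eq_right)
    also have "\<dots> = (\<Sum>k<r. \<Sum>i\<in>I. (\<i> * t) ^ k / fact k * complex_of_real ((u i - v i) * x i ^ k))"
      by (rule sum.swap)
    also have "\<dots> = (\<Sum>k<r. (\<i> * t) ^ k / fact k * complex_of_real (\<Sum>i\<in>I. (u i - v i) * x i ^ k))"
      unfolding sum_distrib_left[symmetric] of_real_sum ..
    also have "cmod \<dots> \<le> (\<Sum>k<r. \<bar>t\<bar> ^ k / fact k * (\<eta> * M ^ r))"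
    proof (rule order_trans[OF norm_sum], rule sum_mono)
      fix k assume "k \<in> {..<r}"
      then have "\<eta> * M ^ k \<le> \<eta> * M ^ r"
        using \<open>1 \<le> M\<close> \<open>0 \<le> \<eta>\<close> by (intro mult_left_mono power_increasing) auto
      with mom[of k] have "\<bar>\<Sum>i\<in>I. (u i - v i) * x i ^ k\<bar> \<le> \<eta> * M ^ r" by linarith
      then show "cmod ((\<i> * t) ^ k / fact k * complex_of_real (\<Sum>i\<in>I. (u i - v i) * x i ^ k))
          \<le> \<bar>t\<bar> ^ k / fact k * (\<eta> * M ^ r)"
        unfolding norm_mult norm_divide norm_power norm_of_real norm_fact
        by (intro mult_mono) auto
    qed
    finally show ?thesis .
  qed
  also have "\<dots> = (\<Sum>k<r. \<bar>t\<bar> ^ k / fact k) * (\<eta> * M ^ r)"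
    by (rule sum_distrib_right[symmetric])
  finally have 2: "cmod (\<Sum>i\<in>I. (u i - v i) *\<^sub>R ?T i) \<le> (\<Sum>k<r. \<bar>t\<bar> ^ k / fact k) * (\<eta> * M ^ r)" .
  have 3: "cmod (\<Sum>i\<in>I. (u i - v i) *\<^sub>R (iexp (t * x i) - ?T i))
      \<le> (\<Sum>i\<in>I. (u i + v i) * (\<bar>t * x i\<bar> ^ r / fact r))"
  proof (rule order_trans[OF norm_sum], rule sum_mono)
    fix i assume "i \<in> I"
    then have "\<bar>u i - v i\<bar> \<le> u i + v i" using u v by (smt (verit))
    then show "cmod ((u i - v i) *\<^sub>R (iexp (t * x i) - ?T i)) \<le> (u i + v i) * (\<bar>t * x i\<bar> ^ r / fact r)"
      unfolding norm_scaleR using approx[of i] by (intro mult_mono) auto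
  qed
  have 4: "(\<Sum>i\<in>I. (u i + v i) * (\<bar>t * x i\<bar> ^ r / fact r))
      = (\<Sum>i\<in>I. (u i - v i) * (\<bar>t * x i\<bar> ^ r / fact r)) + 2 * (\<Sum>i\<in>I. v i * (\<bar>t * x i\<bar> ^ r / fact r))"
    unfolding sum_distrib_left sum.distrib[symmetric]
    by (intro sum.cong refl) (simp add: algebra_simps add_divide_distrib diff_divide_distrib)
  have "(\<Sum>i\<in>I. (u i - v i) * (\<bar>t * x i\<bar> ^ r / fact r))
      = (\<bar>t\<bar> ^ r / fact r) * (\<Sum>i\<in>I. (u i - v i) * x i ^ r)"
    unfolding abs_mult power_mult_distrib sum_distrib_left even
    by (intro sum.cong refl) simp
  also have "\<dots> \<le> (\<bar>t\<bar> ^ r / fact r) * (\<eta> * M ^ r)"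
    using mom[of r] by (intro mult_left_mono) (simp_all add: abs_le_iff)
  finally have 5: "cmod ((\<Sum>i\<in>I. u i *\<^sub>R iexp (t * x i)) - (\<Sum>i\<in>I. v i *\<^sub>R iexp (t * x i)))
    \<le> ((\<Sum>k<r. \<bar>t\<bar> ^ k / fact k) + \<bar>t\<bar> ^ r / fact r) * (\<eta> * M ^ r)
      + 2 * (\<Sum>i\<in>I. v i * (\<bar>t * x i\<bar> ^ r / fact r))"
    using 1 2 3 4 unfolding distrib_right by linarith
  \<comment> \<open>The r-th moment of u - v, which comes from the remainder, supplies the next term
    of the partial exponential series.\<close>
  have 6: "(\<Sum>k<r. \<bar>t\<bar> ^ k / fact k) + \<bar>t\<bar> ^ r / fact r = (\<Sum>k<Suc r. \<bar>t\<bar> ^ k / fact k)"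
    by simp
  have 7: "(\<Sum>k<Suc r. \<bar>t\<bar> ^ k / fact k) \<le> exp \<bar>t\<bar>"
  proof -
    have "(\<Sum>k<Suc r. \<bar>t\<bar> ^ k /\<^sub>R fact k) \<le> (\<Sum>k. \<bar>t\<bar> ^ k /\<^sub>R fact k)"
      by (intro sum_le_suminf summable_exp_generic) auto
    then show ?thesis by (simp add: exp_def divide_inverse mult.commute)
  qed
  have "((\<Sum>k<r. \<bar>t\<bar> ^ k / fact k) + \<bar>t\<bar> ^ r / fact r) * (\<eta> * M ^ r) \<le> exp \<bar>t\<bar> * (\<eta> * M ^ r)"
    unfolding 6 using \<open>1 \<le> M\<close> \<open>0 \<le> \<eta>\<close> by (intro mult_right_mono 7) simp
  with 5 show ?thesis by (simp add: mult.commute)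
qed

section \<open>Exponential moments and normal approximation in the model\<close>

lemma exp_diff_linear_le: "exp c - 1 - c \<le> c\<^sup>2 * exp \<bar>c\<bar>" for c :: real
proof -
  \<comment> \<open>This yields exp c - 1 - c \<le> c (exp c - 1); the second factor c comes from
    |exp c - 1| \<le> |c| exp |c|.\<close>
  have 1: "exp x - 1 \<le> x * exp x" for x :: real
  proof -
    have "(1 - x) * exp x \<le> exp (- x) * exp x"
      using exp_ge_add_one_self[of "- x"] by (intro mult_right_mono) auto
    then show ?thesis by (simp add: exp_minus_inverse mult.commute algebra_simps)
  qed
  have "\<bar>exp c - 1\<bar> \<le> \<bar>c\<bar> * exp \<bar>c\<bar>"
  proof (cases "c \<ge> 0")
    case True
    with 1[of c] show ?thesis by simp
  next
    case False
    then have "\<bar>exp c - 1\<bar> = 1 - exp c" by simp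
    also have "\<dots> \<le> \<bar>c\<bar> * 1" using False exp_ge_add_one_self[of c] by linarith
    also have "\<dots> \<le> \<bar>c\<bar> * exp \<bar>c\<bar>" by (intro mult_left_mono) auto
    finally show ?thesis .
  qed
  then have "\<bar>c\<bar> * \<bar>exp c - 1\<bar> \<le> \<bar>c\<bar> * (\<bar>c\<bar> * exp \<bar>c\<bar>)" by (intro mult_left_mono) auto
  moreover have "exp c - 1 - c \<le> c * (exp c - 1)" using 1[of c] by (simp add: algebra_simps)
  moreover have "c * (exp c - 1) \<le> \<bar>c\<bar> * \<bar>exp c - 1\<bar>" by (metis abs_ge_self abs_mult)
  ultimately show ?thesis by (simp add: power2_eq_square abs_mult[symmetric])
qed

text \<open>For the upper half, multiplication by 1 + z turns 1 - z + z^2 into 1 + z^3, while exp z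
  \<ge> 1 + z gives (1 + z) exp (- z) \<le> 1.\<close>

lemma exp_neg_approx: "\<bar>exp (- z) - (1 - z)\<bar> \<le> z\<^sup>2" if "z \<ge> 0" for z :: real
proof -
  have "(1 + z) * exp (- z) \<le> exp z * exp (- z)"
    using exp_ge_add_one_self[of z] by (intro mult_right_mono) auto
  then have "(1 + z) * exp (- z) \<le> 1" by (simp add: exp_minus_inverse)
  then have "(1 + z) * exp (- z) \<le> (1 + z) * (1 - z + z\<^sup>2)"
  proof -
    have "(1 + z) * (1 - z + z\<^sup>2) = 1 + z ^ 3"
      by (simp add: algebra_simps power2_eq_square power3_eq_cube)
    with that \<open>(1 + z) * exp (- z) \<le> 1\<close> show ?thesis
      using zero_le_power[OF that, of 3] by linarith
  qed
  then have "exp (- z) \<le> 1 - z + z\<^sup>2" using that by (subst (asm) mult_le_cancel_left_pos) auto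
  moreover have "1 - z \<le> exp (- z)" using exp_ge_add_one_self[of "- z"] by simp
  ultimately show ?thesis by simp
qed

text \<open>With c = \<open>\<theta> * a p\<close>, each factor equals (1 + q (exp c - 1)) exp (- c
  q) \<le> exp (q (exp c - 1 - c)): centring removes the linear term. Since |c| \<le> |\<theta>|,
  the bound depends on \<open>P\<close> only through the sum of a^2 q.\<close>

lemma model_exp_moment:
  assumes "finite P" and q: "\<And>p. p \<in> P \<Longrightarrow> 0 \<le> q p \<and> q p \<le> 1"
    and a: "\<And>p. p \<in> P \<Longrightarrow> \<bar>a p\<bar> \<le> 1"
  shows "(\<Sum>E\<in>Pow P. model_weight q P E * exp (\<theta> * centred_sum a q P E))
    \<le> exp (\<theta>\<^sup>2 * exp \<bar>\<theta>\<bar> * (\<Sum>p\<in>P. (a p)\<^sup>2 * q p))"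
proof -
  have "(\<Sum>E\<in>Pow P. model_weight q P E * exp (\<theta> * centred_sum a q P E)) =
      (\<Sum>E\<in>Pow P. of_real (model_weight q P E) * (\<Prod>p\<in>P. exp (\<theta> * a p * (of_bool (p \<in> E) - q p))))"
    using assms(1) by (simp add: centred_sum_def exp_sum sum_distrib_left mult.assoc)
  also have "\<dots> = (\<Prod>p\<in>P. q p * exp (\<theta> * a p * (1 - q p)) + (1 - q p) * exp (\<theta> * a p * (0 - q p)))"
    using model_average_prod[OF assms(1), of q "\<lambda>p b. exp (\<theta> * a p * (of_bool b - q p))"] by simp
  also have "\<dots> \<le> (\<Prod>p\<in>P. exp (\<theta>\<^sup>2 * exp \<bar>\<theta>\<bar> * ((a p)\<^sup>2 * q p)))"
  proof (rule prod_mono, safe)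
    fix p assume p: "p \<in> P"
    show "0 \<le> q p * exp (\<theta> * a p * (1 - q p)) + (1 - q p) * exp (\<theta> * a p * (0 - q p))"
      using q[OF p] by (intro add_nonneg_nonneg mult_nonneg_nonneg) auto
    define c where "c = \<theta> * a p"
    have c: "\<bar>c\<bar> \<le> \<bar>\<theta>\<bar>" using a[OF p] by (simp add: c_def abs_mult mult_left_le)
    have "q p * exp (c * (1 - q p)) + (1 - q p) * exp (c * (0 - q p)) = (1 + q p * (exp c - 1)) * exp (- c * q p)"
      by (simp add: algebra_simps exp_diff exp_minus divide_inverse)
    also have "\<dots> \<le> exp (q p * (exp c - 1)) * exp (- c * q p)"
      using exp_ge_add_one_self by (intro mult_right_mono) auto
    also have "\<dots> = exp (q p * (exp c - 1 - c))" by (simp add: exp_add[symmetric] algebra_simps)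
    also have "\<dots> \<le> exp (q p * (c\<^sup>2 * exp \<bar>\<theta>\<bar>))"
    proof -
      have "c\<^sup>2 * exp \<bar>c\<bar> \<le> c\<^sup>2 * exp \<bar>\<theta>\<bar>" using c by (intro mult_left_mono) auto
      then have "exp c - 1 - c \<le> c\<^sup>2 * exp \<bar>\<theta>\<bar>" using exp_diff_linear_le[of c] by linarith
      then show ?thesis using q[OF p] by (simp add: mult_left_mono)
    qed
    finally show "q p * exp (\<theta> * a p * (1 - q p)) + (1 - q p) * exp (\<theta> * a p * (0 - q p))
        \<le> exp (\<theta>\<^sup>2 * exp \<bar>\<theta>\<bar> * ((a p)\<^sup>2 * q p))"
      by (simp add: c_def power_mult_distrib mult_ac)
  qed
  also have "\<dots> = exp (\<theta>\<^sup>2 * exp \<bar>\<theta>\<bar> * (\<Sum>p\<in>P. (a p)\<^sup>2 * q p))"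
    using assms(1) by (simp add: exp_sum sum_distrib_left)
  finally show ?thesis .
qed

text \<open>The decay 2^(-k) comes from taking exponential moments at 2 t and - 2 t instead of t:
  with x = |t S|, (2 x)^k / k! \<le> exp (2 x). The exponent is \<theta>^2 exp |\<theta>| at
  |\<theta>| = 2 |t|, and the leading 2 accounts for the two signs.\<close>

lemma model_moment_bound:
  assumes "finite P" and q: "\<And>p. p \<in> P \<Longrightarrow> 0 \<le> q p \<and> q p \<le> 1"
    and a: "\<And>p. p \<in> P \<Longrightarrow> \<bar>a p\<bar> \<le> 1" and V: "(\<Sum>p\<in>P. (a p)\<^sup>2 * q p) \<le> 1"
  shows "(\<Sum>E\<in>Pow P. model_weight q P E * (\<bar>t * centred_sum a q P E\<bar> ^ k / fact k))
    \<le> 2 * exp (4 * t\<^sup>2 * exp (2 * \<bar>t\<bar>)) / 2 ^ k"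
proof -
  let ?w = "model_weight q P" and ?S = "centred_sum a q P" and ?C = "exp (4 * t\<^sup>2 * exp (2 * \<bar>t\<bar>))"
  have e: "(\<Sum>E\<in>Pow P. ?w E * exp (s * ?S E)) \<le> ?C" if "\<bar>s\<bar> = 2 * \<bar>t\<bar>" for s
  proof -
    have "s\<^sup>2 = 4 * t\<^sup>2" using that by (metis power2_abs power_mult_distrib four_x_squared)
    then have "s\<^sup>2 * exp \<bar>s\<bar> * (\<Sum>p\<in>P. (a p)\<^sup>2 * q p) \<le> 4 * t\<^sup>2 * exp (2 * \<bar>t\<bar>) * 1"
      unfolding that using V by (intro mult_mono) (auto intro!: sum_nonneg simp: q)
    moreover have "(\<Sum>E\<in>Pow P. ?w E * exp (s * ?S E)) \<le> exp (s\<^sup>2 * exp \<bar>s\<bar> * (\<Sum>p\<in>P. (a p)\<^sup>2 * q p))"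
      using assms by (intro model_exp_moment) auto
    ultimately show ?thesis by (smt (verit) exp_le_cancel_iff)
  qed
  have "?w E * (\<bar>t * ?S E\<bar> ^ k / fact k) \<le> (?w E * exp (2 * t * ?S E) + ?w E * exp (- 2 * t * ?S E)) / 2 ^ k"
    if "E \<in> Pow P" for E
  proof -
    define z where "z = 2 * \<bar>t * ?S E\<bar>"
    have "z ^ k / fact k \<le> exp z"
    proof -
      have "(\<Sum>i\<in>{k}. z ^ i /\<^sub>R fact i) \<le> (\<Sum>i. z ^ i /\<^sub>R fact i)"
        by (intro sum_le_suminf summable_exp_generic) (auto simp: z_def)
      then show ?thesis by (simp add: exp_def divide_inverse mult.commute)
    qed
    also have "\<dots> \<le> exp (2 * t * ?S E) + exp (- 2 * t * ?S E)"
      by (cases "t * ?S E \<ge> 0") (simp_all add: z_def mult.assoc)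
    finally have "(z ^ k / fact k) / 2 ^ k \<le> (exp (2 * t * ?S E) + exp (- 2 * t * ?S E)) / 2 ^ k"
      by (rule divide_right_mono) simp
    moreover have "(z ^ k / fact k) / 2 ^ k = \<bar>t * ?S E\<bar> ^ k / fact k"
      by (simp add: z_def power_mult_distrib)
    ultimately have "?w E * (\<bar>t * ?S E\<bar> ^ k / fact k) \<le> ?w E * ((exp (2 * t * ?S E) + exp (- 2 * t * ?S E)) / 2 ^ k)"
      using model_weight_nonneg[of P q E] q that by (intro mult_left_mono) auto
    then show ?thesis by (simp add: algebra_simps)
  qed
  then have "(\<Sum>E\<in>Pow P. ?w E * (\<bar>t * ?S E\<bar> ^ k / fact k))
      \<le> (\<Sum>E\<in>Pow P. (?w E * exp (2 * t * ?S E) + ?w E * exp (- 2 * t * ?S E)) / 2 ^ k)"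
    by (rule sum_mono)
  also have "\<dots> = ((\<Sum>E\<in>Pow P. ?w E * exp (2 * t * ?S E)) + (\<Sum>E\<in>Pow P. ?w E * exp (- 2 * t * ?S E))) / 2 ^ k"
    by (simp only: sum_divide_distrib[symmetric] sum.distrib)
  also have "\<dots> \<le> (?C + ?C) / 2 ^ k"
    using e[of "2 * t"] e[of "- 2 * t"] by (intro divide_right_mono add_mono) (auto simp: abs_mult)
  finally show ?thesis by simp
qed

text \<open>A Taylor expansion to second order. The linear terms cancel by centring, and the
  quadratic ones give c^2 q (1 - q) / 2. The comparison uses the variance c^2 q instead, because for
  q = 1 / p it reproduces the sum defining \<open>dev_B\<close>; the price is the term c^2
  q^2.\<close>

lemma bernoulli_char_approx:
  fixes c q :: real
  assumes q: "0 \<le> q" "q \<le> 1"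
  shows "cmod (q * iexp (c * (1 - q)) + (1 - q) * iexp (c * (0 - q)) - exp (- (c\<^sup>2 * q / 2)))
    \<le> \<bar>c\<bar> ^ 3 * q + c\<^sup>2 * q\<^sup>2 + c ^ 4 * q"
proof -
  define R where "R x = iexp x - (1 + \<i> * x - complex_of_real (x\<^sup>2 / 2))" for x :: real
  have R: "cmod (R x) \<le> \<bar>x\<bar> ^ 3 / 6" for x
    using iexp_approx1[of x 2]
    by (simp add: R_def numeral_eq_Suc atMost_Suc power_mult_distrib algebra_simps)
  define z where "z = c\<^sup>2 * q / 2"
  have "q * iexp (c * (1 - q)) + (1 - q) * iexp (c * (0 - q)) - exp (- z)
    = q * R (c * (1 - q)) + (1 - q) * R (c * (0 - q)) + complex_of_real (c\<^sup>2 * q\<^sup>2 / 2)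
      - complex_of_real (exp (- z) - (1 - z))"
    unfolding R_def z_def by (simp add: field_simps power2_eq_square)
  also have "cmod \<dots> \<le> q * cmod (R (c * (1 - q))) + (1 - q) * cmod (R (c * (0 - q)))
      + c\<^sup>2 * q\<^sup>2 / 2 + \<bar>exp (- z) - (1 - z)\<bar>"
  proof -
    have "cmod (A + B + complex_of_real X - complex_of_real Y) \<le> cmod A + cmod B + \<bar>X\<bar> + \<bar>Y\<bar>" for A B X Y
      using norm_triangle_ineq4[of "A + B + complex_of_real X" "complex_of_real Y"]
        norm_triangle_ineq[of "A + B" "complex_of_real X"] norm_triangle_ineq[of A B]
      unfolding norm_of_real by linarith
    from this[of "q * R (c * (1 - q))" "(1 - q) * R (c * (0 - q))" "c\<^sup>2 * q\<^sup>2 / 2" "exp (- z) - (1 - z)"]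
    show ?thesis using q by (simp add: norm_mult del: of_real_diff) 
  qed
  also have "\<dots> \<le> q * (\<bar>c\<bar> ^ 3 / 6) + 1 * (\<bar>c\<bar> ^ 3 * q / 6) + c\<^sup>2 * q\<^sup>2 / 2 + c ^ 4 * q"
  proof (intro add_mono mult_left_mono mult_mono order_refl)
    have "\<bar>c * (1 - q)\<bar> ^ 3 \<le> \<bar>c\<bar> ^ 3"
      using q by (intro power_mono) (auto simp: abs_mult mult_left_le)
    with R[of "c * (1 - q)"] show "cmod (R (c * (1 - q))) \<le> \<bar>c\<bar> ^ 3 / 6" by linarith
    have "q ^ 3 \<le> q" using q power_decreasing[of 1 3 q] by simp
    then have "\<bar>c\<bar> ^ 3 * q ^ 3 \<le> \<bar>c\<bar> ^ 3 * q" by (intro mult_left_mono) auto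
    then have "\<bar>c * (0 - q)\<bar> ^ 3 \<le> \<bar>c\<bar> ^ 3 * q" using q by (simp add: abs_mult power_mult_distrib)
    with R[of "c * (0 - q)"] show "cmod (R (c * (0 - q))) \<le> \<bar>c\<bar> ^ 3 * q / 6" by linarith
    have "\<bar>exp (- z) - (1 - z)\<bar> \<le> z\<^sup>2" using q by (intro exp_neg_approx) (simp add: z_def)
    also have "z\<^sup>2 = c ^ 4 * q * (q / 4)" by (simp add: z_def power2_eq_square power4_eq_xxxx)
    also have "\<dots> \<le> c ^ 4 * q * 1" using q by (intro mult_left_mono) auto
    finally show "\<bar>exp (- z) - (1 - z)\<bar> \<le> c ^ 4 * q" by simp
  qed (use q in auto)
  also have "\<dots> \<le> \<bar>c\<bar> ^ 3 * q + c\<^sup>2 * q\<^sup>2 + c ^ 4 * q"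
  proof -
    have "0 \<le> \<bar>c\<bar> ^ 3 * q" "0 \<le> c\<^sup>2 * q\<^sup>2" using q by simp_all
    moreover have "q * (\<bar>c\<bar> ^ 3 / 6) + 1 * (\<bar>c\<bar> ^ 3 * q / 6) = \<bar>c\<bar> ^ 3 * q / 3" by simp
    ultimately show ?thesis by linarith
  qed
  finally show ?thesis unfolding z_def .
qed

lemma cmod_bernoulli_char_le: 
  assumes "0 \<le> q" "q \<le> 1"
  shows "cmod (complex_of_real q * iexp x + complex_of_real (1 - q) * iexp y) \<le> 1"
proof -
  have "cmod (complex_of_real q * iexp x + complex_of_real (1 - q) * iexp y)
      \<le> cmod (complex_of_real q * iexp x) + cmod (complex_of_real (1 - q) * iexp y)"
    by (rule norm_triangle_ineq)
  also have "\<dots> = 1" using assms by (simp add: norm_mult del: of_real_diff)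
  finally show ?thesis .
qed

text \<open>All factors have modulus at most 1, so the products differ by at most the sum of the
  differences of the factors. One \<open>\<epsilon>\<close> is split off from each error term: the
  cubic and quartic ones keep a^2 q, and the variance correction keeps q^2, whose sum over primes is
  bounded for q = 1 / p.\<close>

lemma model_char_approx:
  assumes "finite P" and q: "\<And>p. p \<in> P \<Longrightarrow> 0 \<le> q p \<and> q p \<le> 1"
    and a: "\<And>p. p \<in> P \<Longrightarrow> \<bar>a p\<bar> \<le> \<epsilon>" and \<epsilon>: "0 \<le> \<epsilon>" "\<epsilon> \<le> 1"
  shows "cmod ((\<Sum>E\<in>Pow P. model_weight q P E *\<^sub>R iexp (t * centred_sum a q P E))
      - exp (- (t\<^sup>2 / 2 * (\<Sum>p\<in>P. (a p)\<^sup>2 * q p))))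
    \<le> \<epsilon> * ((\<bar>t\<bar> ^ 3 + t ^ 4) * (\<Sum>p\<in>P. (a p)\<^sup>2 * q p) + t\<^sup>2 * (\<Sum>p\<in>P. (q p)\<^sup>2))"
proof -
  have "(\<Sum>E\<in>Pow P. model_weight q P E *\<^sub>R iexp (t * centred_sum a q P E)) =
      (\<Sum>E\<in>Pow P. of_real (model_weight q P E) * (\<Prod>p\<in>P. iexp (t * a p * (of_bool (p \<in> E) - q p))))"
    using assms(1)
    by (simp add: centred_sum_def exp_sum[symmetric] sum_distrib_left mult.assoc scaleR_conv_of_real)
  also have "\<dots> = (\<Prod>p\<in>P. q p * iexp (t * a p * (1 - q p)) + (1 - q p) * iexp (t * a p * (0 - q p)))"
    using model_average_prod[OF assms(1), of q "\<lambda>p b. iexp (t * a p * (of_bool b - q p))"] by simp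
  finally have eq: "(\<Sum>E\<in>Pow P. model_weight q P E *\<^sub>R iexp (t * centred_sum a q P E)) = \<dots>" .
  have eq2: "complex_of_real (exp (- (t\<^sup>2 / 2 * (\<Sum>p\<in>P. (a p)\<^sup>2 * q p)))) =
      (\<Prod>p\<in>P. complex_of_real (exp (- ((t * a p)\<^sup>2 * q p / 2))))"
    using assms(1)
    by (simp add: of_real_prod[symmetric] exp_sum[symmetric] sum_negf[symmetric] sum_distrib_left
        power_mult_distrib mult_ac del: of_real_prod of_real_exp)
  have "cmod ((\<Prod>p\<in>P. q p * iexp (t * a p * (1 - q p)) + (1 - q p) * iexp (t * a p * (0 - q p)))
      - (\<Prod>p\<in>P. complex_of_real (exp (- ((t * a p)\<^sup>2 * q p / 2)))))
    \<le> (\<Sum>p\<in>P. cmod (q p * iexp (t * a p * (1 - q p)) + (1 - q p) * iexp (t * a p * (0 - q p))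
      - complex_of_real (exp (- ((t * a p)\<^sup>2 * q p / 2)))))"
  proof (rule norm_prod_diff)
    fix p assume "p \<in> P"
    then show "cmod (q p * iexp (t * a p * (1 - q p)) + (1 - q p) * iexp (t * a p * (0 - q p))) \<le> 1"
      using q cmod_bernoulli_char_le by blast
    show "cmod (complex_of_real (exp (- ((t * a p)\<^sup>2 * q p / 2)))) \<le> 1"
      using q[OF \<open>p \<in> P\<close>] by (simp del: of_real_exp)
  qed
  moreover have "\<dots> \<le> (\<Sum>p\<in>P. \<epsilon> * ((\<bar>t\<bar> ^ 3 + t ^ 4) * ((a p)\<^sup>2 * q p) + t\<^sup>2 * (q p)\<^sup>2))"
  proof (rule sum_mono)
    fix p assume p: "p \<in> P"
    have q': "0 \<le> q p" "q p \<le> 1" using q[OF p] by auto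
    have a2: "(a p)\<^sup>2 \<le> \<epsilon>"
    proof -
      have "\<bar>a p\<bar> * \<bar>a p\<bar> \<le> \<epsilon> * 1" using a[OF p] \<epsilon> by (intro mult_mono) auto
      then show ?thesis by (simp add: power2_eq_square abs_mult[symmetric])
    qed
    have "\<bar>t * a p\<bar> ^ 3 * q p = (\<bar>t\<bar> ^ 3 * ((a p)\<^sup>2 * q p)) * \<bar>a p\<bar>"
    proof -
      have "\<bar>a p\<bar> ^ 3 = (a p)\<^sup>2 * \<bar>a p\<bar>" by (simp add: power3_eq_cube power2_eq_square abs_mult[symmetric])
      then show ?thesis by (simp only: power_mult_distrib abs_mult mult_ac)
    qed
    also have "\<dots> \<le> (\<bar>t\<bar> ^ 3 * ((a p)\<^sup>2 * q p)) * \<epsilon>"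
      using a[OF p] q' by (intro mult_left_mono) auto
    finally have 1: "\<bar>t * a p\<bar> ^ 3 * q p \<le> \<epsilon> * (\<bar>t\<bar> ^ 3 * ((a p)\<^sup>2 * q p))" by (simp add: mult_ac)
    have "(t * a p)\<^sup>2 * (q p)\<^sup>2 = (t\<^sup>2 * (q p)\<^sup>2) * (a p)\<^sup>2" by (simp add: power_mult_distrib)
    also have "\<dots> \<le> (t\<^sup>2 * (q p)\<^sup>2) * \<epsilon>" using a2 by (intro mult_left_mono) auto
    finally have 2: "(t * a p)\<^sup>2 * (q p)\<^sup>2 \<le> \<epsilon> * (t\<^sup>2 * (q p)\<^sup>2)" by (simp add: mult_ac)
    have "(t * a p) ^ 4 * q p = (t ^ 4 * ((a p)\<^sup>2 * q p)) * (a p)\<^sup>2"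
      by (simp add: power_mult_distrib power4_eq_xxxx power2_eq_square)
    also have "\<dots> \<le> (t ^ 4 * ((a p)\<^sup>2 * q p)) * \<epsilon>" using a2 q' by (intro mult_left_mono) auto
    finally have 3: "(t * a p) ^ 4 * q p \<le> \<epsilon> * (t ^ 4 * ((a p)\<^sup>2 * q p))" by (simp add: mult_ac)
    have "\<epsilon> * ((\<bar>t\<bar> ^ 3 + t ^ 4) * ((a p)\<^sup>2 * q p) + t\<^sup>2 * (q p)\<^sup>2) =
        \<epsilon> * (\<bar>t\<bar> ^ 3 * ((a p)\<^sup>2 * q p)) + \<epsilon> * (t\<^sup>2 * (q p)\<^sup>2) + \<epsilon> * (t ^ 4 * ((a p)\<^sup>2 * q p))"
      by (simp add: algebra_simps)
    with 1 2 3 bernoulli_char_approx[OF q', of "t * a p"]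
    show "cmod (q p * iexp (t * a p * (1 - q p)) + (1 - q p) * iexp (t * a p * (0 - q p))
        - complex_of_real (exp (- ((t * a p)\<^sup>2 * q p / 2))))
      \<le> \<epsilon> * ((\<bar>t\<bar> ^ 3 + t ^ 4) * ((a p)\<^sup>2 * q p) + t\<^sup>2 * (q p)\<^sup>2)" by linarith
  qed
  moreover have "\<dots> = \<epsilon> * ((\<bar>t\<bar> ^ 3 + t ^ 4) * (\<Sum>p\<in>P. (a p)\<^sup>2 * q p) + t\<^sup>2 * (\<Sum>p\<in>P. (q p)\<^sup>2))"
    by (simp only: sum_distrib_left[symmetric] sum.distrib)
  ultimately show ?thesis unfolding eq eq2 by linarith
qed

subsection \<open>Divisibility by small primes\<close>

definition divisor_density :: "nat \<Rightarrow> nat set \<Rightarrow> nat set \<Rightarrow> real" where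
  "divisor_density n P E = card {m\<in>{1..n}. {p\<in>P. p dvd m} = E} / n"

lemma divisor_density_average:
  fixes F :: "nat set \<Rightarrow> 'a::real_vector"
  assumes "finite P"
  shows "(\<Sum>E\<in>Pow P. divisor_density n P E *\<^sub>R F E) = (\<Sum>m\<in>{1..n}. F {p\<in>P. p dvd m}) /\<^sub>R n"
proof -
  have "(\<Sum>m\<in>{1..n}. F {p\<in>P. p dvd m}) =
      (\<Sum>E\<in>Pow P. \<Sum>m | m \<in> {1..n} \<and> {p\<in>P. p dvd m} = E. F {p\<in>P. p dvd m})"
    using assms by (intro sum.group[symmetric]) auto
  also have "\<dots> = (\<Sum>E\<in>Pow P. real (card {m\<in>{1..n}. {p\<in>P. p dvd m} = E}) *\<^sub>R F E)"
  proof (rule sum.cong[OF refl])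
    fix E
    have "(\<Sum>m | m \<in> {1..n} \<and> {p\<in>P. p dvd m} = E. F {p\<in>P. p dvd m})
        = (\<Sum>m | m \<in> {1..n} \<and> {p\<in>P. p dvd m} = E. F E)"
      by (intro sum.cong) auto
    then show "(\<Sum>m | m \<in> {1..n} \<and> {p\<in>P. p dvd m} = E. F {p\<in>P. p dvd m})
        = real (card {m\<in>{1..n}. {p\<in>P. p dvd m} = E}) *\<^sub>R F E"
      by (simp only: sum_constant_scaleR)
  qed
  finally show ?thesis
    by (simp add: divisor_density_def scaleR_sum_right divide_inverse mult.commute)
qed

text \<open>\<open>D\<close> lies in the set of prime divisors of m exactly when its product divides
  m. In the model this event has probability exactly 1 / \<open>\<Prod>D\<close>; the frequency
  among m \<le> n differs by at most 1 / n, uniformly in \<open>D\<close>, even if the product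
  exceeds n.\<close>

lemma divisor_density_model:
  assumes "finite P" "\<And>p. p \<in> P \<Longrightarrow> prime p" "n > 0" "D \<subseteq> P"
  shows "\<bar>\<Sum>E\<in>Pow P. (divisor_density n P E - model_weight (\<lambda>p. 1 / real p) P E) * of_bool (D \<subseteq> E)\<bar> \<le> 1 / n"
proof -
  have D: "finite D" "\<And>p. p \<in> D \<Longrightarrow> prime p" using assms finite_subset by auto
  then have pos: "\<Prod>D > 0" by (intro prod_pos) (auto simp: prime_gt_0_nat)
  have sub: "D \<subseteq> {p\<in>P. p dvd m} \<longleftrightarrow> \<Prod>D dvd m" for m
    using D assms by (auto simp: prod_distinct_primes_dvd_iff)
  have 1: "(\<Sum>E\<in>Pow P. divisor_density n P E * of_bool (D \<subseteq> E)) = card {m\<in>{1..n}. \<Prod>D dvd m} / n"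
  proof -
    have "(\<Sum>E\<in>Pow P. divisor_density n P E * of_bool (D \<subseteq> E)) = (\<Sum>m\<in>{1..n}. of_bool (D \<subseteq> {p\<in>P. p dvd m})) / n"
      using divisor_density_average[OF assms(1), of n "\<lambda>E. of_bool (D \<subseteq> E) :: real"]
      by (simp add: divide_inverse mult.commute)
    also have "(\<Sum>m\<in>{1..n}. of_bool (D \<subseteq> {p\<in>P. p dvd m})) = real (card {m\<in>{1..n}. \<Prod>D dvd m})"
      unfolding sub by (simp add: sum_of_bool_eq Int_def)
    finally show ?thesis .
  qed
  have 2: "(\<Sum>E\<in>Pow P. model_weight (\<lambda>p. 1 / real p) P E * of_bool (D \<subseteq> E)) = 1 / real (\<Prod>D)"
  proof -
    \<comment> \<open>The indicator of \<open>D \<subseteq> E\<close> is written as a product over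
      all of \<open>P\<close>, with factors 1 outside \<open>D\<close>, so that independence
      applies.\<close>
    have "(\<Sum>E\<in>Pow P. model_weight (\<lambda>p. 1 / real p) P E * of_bool (D \<subseteq> E)) =
        (\<Sum>E\<in>Pow P. model_weight (\<lambda>p. 1 / real p) P E * (\<Prod>p\<in>P. of_bool (p \<in> D \<longrightarrow> p \<in> E)))"
    proof (intro sum.cong refl arg_cong2[where f = "(*)"])
      fix E show "of_bool (D \<subseteq> E) = (\<Prod>p\<in>P. of_bool (p \<in> D \<longrightarrow> p \<in> E) :: real)"
      proof (cases "D \<subseteq> E")
        case False
        then obtain p where "p \<in> D" "p \<notin> E" by auto
        then have "(\<Prod>p\<in>P. of_bool (p \<in> D \<longrightarrow> p \<in> E) :: real) = 0"
          using assms by (intro prod_zero) auto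
        with False show ?thesis by simp
      next
        case True
        then have "(\<Prod>p\<in>P. of_bool (p \<in> D \<longrightarrow> p \<in> E) :: real) = 1" by (intro prod.neutral) auto
        with True show ?thesis by simp
      qed
    qed
    also have "\<dots> = (\<Prod>p\<in>P. 1 / real p * of_bool (p \<in> D \<longrightarrow> True) + (1 - 1 / real p) * of_bool (p \<in> D \<longrightarrow> False))"
      using model_average_prod[OF assms(1), of "\<lambda>p. 1 / real p" "\<lambda>p b. of_bool (p \<in> D \<longrightarrow> b) :: real"]
      by simp
    also have "\<dots> = (\<Prod>p\<in>P. if p \<in> D then 1 / real p else 1)"
      by (intro prod.cong) auto
    also have "\<dots> = (\<Prod>p\<in>D. 1 / real p)"
      using assms by (simp add: prod.If_cases Int_absorb1)
    finally show ?thesis by (simp add: prod_dividef)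
  qed
  show ?thesis
    using density_multiples(2)[OF pos \<open>n > 0\<close>] by (simp only: left_diff_distrib sum_subtractf 1 2)
qed

text \<open>For a p = f p / B and y = n this is the strongly additive counterpart of (f - A) / B.
  Indicators are centred at the model probability 1 / p, not at their frequency among m \<le> n, so
  that the centring constants add up to A / B.\<close>

definition prime_sum :: "(nat \<Rightarrow> real) \<Rightarrow> nat \<Rightarrow> nat \<Rightarrow> real" where
  "prime_sum a y m = (\<Sum>p\<in>primes_upto y. a p * (of_bool (p dvd m) - 1 / real p))"

lemma card_primes_upto_le: "card (primes_upto y) \<le> y"
proof -
  have "primes_upto y \<subseteq> {1..y}"
    by (auto simp: primes_upto_def Suc_le_eq prime_gt_0_nat)
  then show ?thesis using card_mono[of "{1..y}"] by fastforce
qed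

lemma prime_sum_char_model:
  assumes "n > 0" "y > 0" "even r" "r > 0"
    and a: "\<And>p. p \<in> primes_upto y \<Longrightarrow> \<bar>a p\<bar> \<le> 1"
    and V: "(\<Sum>p\<in>primes_upto y. (a p)\<^sup>2 / real p) \<le> 1"
  shows "cmod ((\<Sum>m\<in>{1..n}. iexp (t * prime_sum a y m)) /\<^sub>R n
      - (\<Sum>E\<in>Pow (primes_upto y). model_weight (\<lambda>p. 1 / real p) (primes_upto y) E *\<^sub>R
          iexp (t * centred_sum a (\<lambda>p. 1 / real p) (primes_upto y) E)))
    \<le> 1 / real n * real (2 * y) ^ r * exp \<bar>t\<bar> + 4 * exp (4 * t\<^sup>2 * exp (2 * \<bar>t\<bar>)) / 2 ^ r"
proof -
  let ?P = "primes_upto y" and ?q = "\<lambda>p. 1 / real p"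
  let ?w = "model_weight ?q ?P" and ?d = "divisor_density n ?P" and ?S = "centred_sum a ?q ?P"
  have q: "0 \<le> ?q p \<and> ?q p \<le> 1" if "p \<in> ?P" for p
    using that prime_gt_0_nat[of p] by (auto simp: primes_upto_def)
  \<comment> \<open>A trivial count: at most y primes, each of weight at most 2. The loss is
    affordable because the resulting power of 2 y is divided by n.\<close>
  have M: "(\<Sum>p\<in>?P. \<bar>a p\<bar> * (1 + ?q p)) \<le> real (2 * y)"
  proof -
    have "(\<Sum>p\<in>?P. \<bar>a p\<bar> * (1 + ?q p)) \<le> (\<Sum>p\<in>?P. 1 * 2)"
      using a q by (intro sum_mono mult_mono) auto
    also have "\<dots> \<le> 2 * real y" using card_primes_upto_le[of y] by simp
    finally show ?thesis by simp
  qed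
  have "prime_sum a y m = ?S {p\<in>?P. p dvd m}" for m
    by (simp add: prime_sum_def centred_sum_def)
  then have eq: "(\<Sum>m\<in>{1..n}. iexp (t * prime_sum a y m)) /\<^sub>R n = (\<Sum>E\<in>Pow ?P. ?d E *\<^sub>R iexp (t * ?S E))"
    using divisor_density_average[OF finite_primes_upto, of n y "\<lambda>E. iexp (t * ?S E)"] by simp
  have mom: "\<bar>\<Sum>E\<in>Pow ?P. (?d E - ?w E) * ?S E ^ k\<bar> \<le> 1 / real n * real (2 * y) ^ k" for k
  proof -
    have "\<bar>\<Sum>E\<in>Pow ?P. (?d E - ?w E) * (of_bool ({} \<subseteq> E) * ?S E ^ k)\<bar>
        \<le> 1 / real n * (\<Sum>p\<in>?P. \<bar>a p\<bar> * (1 + ?q p)) ^ k"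
      using q \<open>n > 0\<close> by (intro signed_moment_bound divisor_density_model) (auto simp: primes_upto_def)
    also have "\<dots> \<le> 1 / real n * real (2 * y) ^ k"
      using M q by (intro mult_left_mono power_mono sum_nonneg) auto
    finally show ?thesis by simp
  qed
  have "cmod ((\<Sum>E\<in>Pow ?P. ?d E *\<^sub>R iexp (t * ?S E)) - (\<Sum>E\<in>Pow ?P. ?w E *\<^sub>R iexp (t * ?S E)))
      \<le> 1 / real n * real (2 * y) ^ r * exp \<bar>t\<bar> + 2 * (\<Sum>E\<in>Pow ?P. ?w E * (\<bar>t * ?S E\<bar> ^ r / fact r))"
  proof (rule char_difference_bound[OF _ _ mom])
    show "0 \<le> ?d E" for E by (simp add: divisor_density_def)
    show "0 \<le> ?w E" if "E \<in> Pow ?P" for E using q that by (intro model_weight_nonneg) auto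
  qed (use assms in auto)
  also have "(\<Sum>E\<in>Pow ?P. ?w E * (\<bar>t * ?S E\<bar> ^ r / fact r)) \<le> 2 * exp (4 * t\<^sup>2 * exp (2 * \<bar>t\<bar>)) / 2 ^ r"
    using q a V by (intro model_moment_bound) auto
  finally show ?thesis unfolding eq by simp
qed

section \<open>From the primes below the cut-off to all primes up to n\<close>

lemma exp_neg_diff_le: "\<bar>exp (- x) - exp (- y)\<bar> \<le> \<bar>x - y\<bar>" if "0 \<le> x" "0 \<le> y" for x y :: real
proof -
  have *: "exp (- x) - exp (- y) \<le> y - x" if "0 \<le> x" "x \<le> y" for x y :: real
  proof -
    have "exp (- x) - exp (- y) = exp (- x) * (1 - exp (x - y))"
      by (simp add: algebra_simps exp_add[symmetric])
    also have "\<dots> \<le> 1 * (y - x)"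
    proof (intro mult_mono)
      show "1 - exp (x - y) \<le> y - x" using exp_ge_add_one_self[of "x - y"] by linarith
    qed (use that in auto)
    finally show ?thesis by simp
  qed
  show ?thesis
    using *[of x y] *[of y x] that by (cases "x \<le> y") auto
qed

lemma cmod_iexp_diff_le: "cmod (iexp x - iexp y) \<le> \<bar>x - y\<bar>"
proof -
  have "iexp x - iexp y = iexp y * (iexp (x - y) - 1)"
    by (simp add: algebra_simps exp_add[symmetric])
  then have "cmod (iexp x - iexp y) = cmod (iexp (x - y) - 1)" by (simp add: norm_mult)
  also have "\<dots> \<le> \<bar>x - y\<bar>" using iexp_approx1[of "x - y" 0] by simp
  finally show ?thesis .
qed

lemma cmod_average_iexp_diff_le:
  "cmod ((\<Sum>m\<in>{1..n}. iexp (t * x m)) /\<^sub>R n - (\<Sum>m\<in>{1..n}. iexp (t * y m)) /\<^sub>R n)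
    \<le> \<bar>t\<bar> * ((\<Sum>m\<in>{1..n}. \<bar>x m - y m\<bar>) / n)" for n :: nat
proof -
  have "cmod ((\<Sum>m\<in>{1..n}. iexp (t * x m)) /\<^sub>R n - (\<Sum>m\<in>{1..n}. iexp (t * y m)) /\<^sub>R n)
      = cmod (\<Sum>m\<in>{1..n}. iexp (t * x m) - iexp (t * y m)) / n"
    by (simp add: scaleR_diff_right[symmetric] sum_subtractf divide_inverse mult.commute)
  also have "\<dots> \<le> (\<Sum>m\<in>{1..n}. \<bar>t\<bar> * \<bar>x m - y m\<bar>) / n"
  proof (intro divide_right_mono order_trans[OF norm_sum] sum_mono)
    fix m show "cmod (iexp (t * x m) - iexp (t * y m)) \<le> \<bar>t\<bar> * \<bar>x m - y m\<bar>"
      using cmod_iexp_diff_le[of "t * x m" "t * y m"] by (simp add: abs_mult[symmetric] algebra_simps)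
  qed simp
  finally show ?thesis by (simp add: sum_distrib_left)
qed

text \<open>No cancellation is used: each prime p beyond y adds at most \<open>\<epsilon>\<close> (1
  / p + 1 / p) to the mean absolute value, one part from the frequency of its multiples and one from
  the centring.\<close>

lemma average_prime_sum_tail_le:
  assumes "n > 0" "y \<le> n" and a: "\<And>p. p \<in> primes_upto n \<Longrightarrow> \<bar>a p\<bar> \<le> \<epsilon>"
  shows "(\<Sum>m\<in>{1..n}. \<bar>prime_sum a n m - prime_sum a y m\<bar>) / n
    \<le> 2 * \<epsilon> * (\<Sum>p\<in>primes_upto n - primes_upto y. 1 / real p)"
proof -
  let ?T = "primes_upto n - primes_upto y"
  have "primes_upto y \<subseteq> primes_upto n" using assms by (auto simp: primes_upto_def)
  then have diff: "prime_sum a n m - prime_sum a y m = (\<Sum>p\<in>?T. a p * (of_bool (p dvd m) - 1 / real p))" for m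
    by (simp add: prime_sum_def sum_diff)
  have "(\<Sum>m\<in>{1..n}. \<bar>prime_sum a n m - prime_sum a y m\<bar>)
      \<le> (\<Sum>m\<in>{1..n}. \<Sum>p\<in>?T. \<epsilon> * (of_bool (p dvd m) + 1 / real p))"
    unfolding diff
  proof (intro sum_mono order_trans[OF sum_abs])
    fix m p assume "p \<in> ?T"
    then show "\<bar>a p * (of_bool (p dvd m) - 1 / real p)\<bar> \<le> \<epsilon> * (of_bool (p dvd m) + 1 / real p)"
      unfolding abs_mult using a[of p] abs_triangle_ineq4[of "of_bool (p dvd m)" "1 / real p"]
      by (intro mult_mono) auto
  qed
  also have "\<dots> = (\<Sum>p\<in>?T. \<epsilon> * (real (card {m\<in>{1..n}. p dvd m}) + n / real p))"
    by (subst sum.swap) (simp add: sum_distrib_left[symmetric] sum.distrib sum_of_bool_eq Int_def)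
  finally have "(\<Sum>m\<in>{1..n}. \<bar>prime_sum a n m - prime_sum a y m\<bar>) / n
      \<le> (\<Sum>p\<in>?T. \<epsilon> * (real (card {m\<in>{1..n}. p dvd m}) + n / real p)) / n"
    by (rule divide_right_mono) simp
  also have "\<dots> = (\<Sum>p\<in>?T. \<epsilon> * (card {m\<in>{1..n}. p dvd m} / n + 1 / real p))"
    unfolding sum_divide_distrib using \<open>n > 0\<close> by (intro sum.cong refl) (simp add: field_simps)
  also have "\<dots> \<le> (\<Sum>p\<in>?T. \<epsilon> * (1 / real p + 1 / real p))"
  proof (intro sum_mono mult_left_mono add_mono order_refl)
    fix p assume "p \<in> ?T"
    then have "p > 0" "p \<in> primes_upto n" by (auto simp: primes_upto_def prime_gt_0_nat)
    with density_multiples(1)[of p n] \<open>n > 0\<close>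
    show "card {m\<in>{1..n}. p dvd m} / n \<le> 1 / real p" by simp
    show "0 \<le> \<epsilon>" using a[OF \<open>p \<in> primes_upto n\<close>] by linarith
  qed
  also have "\<dots> = 2 * \<epsilon> * (\<Sum>p\<in>?T. 1 / real p)"
    unfolding sum_distrib_left by (intro sum.cong refl) simp
  finally show ?thesis .
qed

text \<open>\<open>C\<close> depends only on r and t and is fixed before n, a and
  \<open>\<epsilon>\<close>. For fixed r the first term thus vanishes as n grows and
  \<open>\<epsilon>\<close> tends to 0; the other is the Taylor remainder, made small by the choice
  of r.\<close>

lemma prime_sum_char_bound:
  fixes t :: real
  assumes "even r" "r > 0"
  shows "\<exists>C. \<forall>n a \<epsilon>. 2 ^ (2 * r) \<le> n \<longrightarrow> 0 \<le> \<epsilon> \<longrightarrow> \<epsilon> \<le> 1 \<longrightarrow>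
    (\<forall>p\<in>primes_upto n. \<bar>a p\<bar> \<le> \<epsilon>) \<longrightarrow> (\<Sum>p\<in>primes_upto n. (a p)\<^sup>2 / real p) = 1 \<longrightarrow>
    cmod ((\<Sum>m\<in>{1..n}. iexp (t * prime_sum a n m)) /\<^sub>R n - complex_of_real (exp (- (t\<^sup>2 / 2))))
      \<le> C * (\<epsilon> + 1 / sqrt n) + 4 * exp (4 * t\<^sup>2 * exp (2 * \<bar>t\<bar>)) / 2 ^ r"
proof -
  \<comment> \<open>One summand per comparison: the primes between the cut-off and n, the moments in
    the Taylor expansion, the normal approximation in the model, and the variance lost at the
    cut-off.\<close>
  define C where "C = 16 * r * \<bar>t\<bar> + 2 ^ r * exp \<bar>t\<bar> + (\<bar>t\<bar> ^ 3 + t ^ 4 + t\<^sup>2) + 4 * r * t\<^sup>2"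
  let ?q = "\<lambda>p. 1 / real p"
  show ?thesis
  proof (rule exI[of _ C], intro allI impI)
    fix n a \<epsilon>
    assume n: "2 ^ (2 * r) \<le> n" and \<epsilon>: "0 \<le> \<epsilon>" "\<epsilon> \<le> 1" and "\<forall>p\<in>primes_upto n. \<bar>a p\<bar> \<le> \<epsilon>"
      and V: "(\<Sum>p\<in>primes_upto n. (a p)\<^sup>2 / real p) = 1"
    then have a: "\<bar>a p\<bar> \<le> \<epsilon>" if "p \<in> primes_upto n" for p using that by auto
    \<comment> \<open>The exponent is twice the Taylor order: then y^r \<le> sqrt n, and the factor
      (2 y)^r / n of the moment comparison is at most 2^r / sqrt n.\<close>
    obtain y where y: "y ^ (2 * r) \<le> n" "0 < y" "y \<le> n"
      and tail: "(\<Sum>p\<in>primes_upto n - primes_upto y. 1 / real p) \<le> 4 * real (2 * r)"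
      using exists_cutoff[of "2 * r" n] n \<open>r > 0\<close> by auto
    have "n > 0" using y by simp
    let ?P = "primes_upto y"
    have sub: "?P \<subseteq> primes_upto n" using y by (auto simp: primes_upto_def)
    define Vy where "Vy = (\<Sum>p\<in>?P. (a p)\<^sup>2 * ?q p)"
    have q: "0 \<le> ?q p \<and> ?q p \<le> 1" if "p \<in> ?P" for p
      using that prime_gt_0_nat[of p] by (auto simp: primes_upto_def)
    have "Vy \<ge> 0" unfolding Vy_def by (intro sum_nonneg) auto
    have Vdiff: "1 - Vy = (\<Sum>p\<in>primes_upto n - ?P. (a p)\<^sup>2 / real p)"
      using sub V by (simp add: Vy_def sum_diff)
    also have "\<dots> \<le> (\<Sum>p\<in>primes_upto n - ?P. \<epsilon> * (1 / real p))"
    proof (rule sum_mono)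
      fix p assume "p \<in> primes_upto n - ?P"
      then have "\<bar>a p\<bar> * \<bar>a p\<bar> \<le> \<epsilon> * 1" using a[of p] \<epsilon> by (intro mult_mono) auto
      then have "(a p)\<^sup>2 \<le> \<epsilon>" by (simp add: power2_eq_square abs_mult[symmetric])
      then show "(a p)\<^sup>2 / real p \<le> \<epsilon> * (1 / real p)" by (simp add: divide_right_mono)
    qed
    also have "\<dots> \<le> \<epsilon> * (8 * r)"
      unfolding sum_distrib_left[symmetric] using tail \<epsilon> by (intro mult_left_mono) auto
    finally have V1: "1 - Vy \<le> \<epsilon> * (8 * r)" .
    have V0: "0 \<le> 1 - Vy" unfolding Vdiff by (intro sum_nonneg) auto

    have 1: "cmod ((\<Sum>m\<in>{1..n}. iexp (t * prime_sum a n m)) /\<^sub>R n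
        - (\<Sum>m\<in>{1..n}. iexp (t * prime_sum a y m)) /\<^sub>R n) \<le> 16 * r * \<bar>t\<bar> * \<epsilon>"
    proof (rule order_trans[OF cmod_average_iexp_diff_le])
      have "(\<Sum>m\<in>{1..n}. \<bar>prime_sum a n m - prime_sum a y m\<bar>) / n
          \<le> 2 * \<epsilon> * (\<Sum>p\<in>primes_upto n - primes_upto y. 1 / real p)"
        using \<open>n > 0\<close> y a by (intro average_prime_sum_tail_le) auto
      also have "\<dots> \<le> 2 * \<epsilon> * (4 * real (2 * r))" using tail \<epsilon> by (intro mult_left_mono) auto
      finally have "\<bar>t\<bar> * ((\<Sum>m\<in>{1..n}. \<bar>prime_sum a n m - prime_sum a y m\<bar>) / n)
          \<le> \<bar>t\<bar> * (2 * \<epsilon> * (4 * real (2 * r)))" by (intro mult_left_mono) auto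
      then show "\<bar>t\<bar> * ((\<Sum>m\<in>{1..n}. \<bar>prime_sum a n m - prime_sum a y m\<bar>) / n) \<le> 16 * r * \<bar>t\<bar> * \<epsilon>"
        by (simp add: mult_ac)
    qed
    let ?mod = "\<Sum>E\<in>Pow ?P. model_weight ?q ?P E *\<^sub>R iexp (t * centred_sum a ?q ?P E)"
    have 2: "cmod ((\<Sum>m\<in>{1..n}. iexp (t * prime_sum a y m)) /\<^sub>R n - ?mod)
        \<le> 1 / real n * real (2 * y) ^ r * exp \<bar>t\<bar> + 4 * exp (4 * t\<^sup>2 * exp (2 * \<bar>t\<bar>)) / 2 ^ r"
    proof (rule prime_sum_char_model)
      show "\<bar>a p\<bar> \<le> 1" if "p \<in> ?P" for p using a[of p] sub that \<epsilon> by force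
      show "(\<Sum>p\<in>?P. (a p)\<^sup>2 / real p) \<le> 1" using V0 by (simp add: Vy_def)
    qed (use assms \<open>n > 0\<close> y in auto)
    have 3: "1 / real n * real (2 * y) ^ r * exp \<bar>t\<bar> \<le> 2 ^ r * exp \<bar>t\<bar> * (1 / sqrt n)"
    proof -
      have "(real y ^ r)\<^sup>2 \<le> real n"
        using y(1) by (metis mult.commute of_nat_le_iff of_nat_power power_mult)
      then have "real y ^ r \<le> sqrt n" by (rule real_le_rsqrt)
      then have "real y ^ r / n \<le> sqrt n / n" by (rule divide_right_mono) simp
      also have "\<dots> = 1 / sqrt n" using \<open>n > 0\<close> by (simp add: real_div_sqrt field_simps)
      finally have "2 ^ r * exp \<bar>t\<bar> * (real y ^ r / n) \<le> 2 ^ r * exp \<bar>t\<bar> * (1 / sqrt n)"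
        by (intro mult_left_mono) auto
      then show ?thesis by (simp add: power_mult_distrib mult_ac)
    qed
    have 4: "cmod (?mod - exp (- (t\<^sup>2 / 2 * Vy))) \<le> \<epsilon> * (\<bar>t\<bar> ^ 3 + t ^ 4 + t\<^sup>2)"
    proof -
      have "cmod (?mod - exp (- (t\<^sup>2 / 2 * Vy))) \<le> \<epsilon> * ((\<bar>t\<bar> ^ 3 + t ^ 4) * Vy + t\<^sup>2 * (\<Sum>p\<in>?P. (?q p)\<^sup>2))"
        unfolding Vy_def using q a sub \<epsilon> by (intro model_char_approx) auto
      also have "\<dots> \<le> \<epsilon> * ((\<bar>t\<bar> ^ 3 + t ^ 4) * 1 + t\<^sup>2 * 1)"
        using V0 \<epsilon> sum_inverse_squares_primes_le[of y]
        by (intro mult_left_mono add_mono) (auto simp: power_divide)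
      finally show ?thesis by simp
    qed
    have 5: "cmod (complex_of_real (exp (- (t\<^sup>2 / 2 * Vy))) - complex_of_real (exp (- (t\<^sup>2 / 2)))) \<le> 4 * r * t\<^sup>2 * \<epsilon>"
    proof -
      have "cmod (complex_of_real (exp (- (t\<^sup>2 / 2 * Vy))) - complex_of_real (exp (- (t\<^sup>2 / 2))))
          = \<bar>exp (- (t\<^sup>2 / 2 * Vy)) - exp (- (t\<^sup>2 / 2))\<bar>"
        by (metis norm_of_real of_real_diff)
      also have "\<dots> \<le> \<bar>t\<^sup>2 / 2 * Vy - t\<^sup>2 / 2\<bar>" using \<open>Vy \<ge> 0\<close> by (intro exp_neg_diff_le) auto
      also have "t\<^sup>2 / 2 * Vy - t\<^sup>2 / 2 = - (t\<^sup>2 / 2 * (1 - Vy))" by (simp only: right_diff_distrib mult_1_right minus_diff_eq)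
      also have "\<bar>\<dots>\<bar> = t\<^sup>2 / 2 * (1 - Vy)" using V0 by (subst abs_minus_cancel) (intro abs_of_nonneg, simp)
      also have "\<dots> \<le> t\<^sup>2 / 2 * (\<epsilon> * (8 * r))" using V1 by (intro mult_left_mono) auto
      finally show ?thesis by (simp add: mult_ac)
    qed
    have tri: "cmod (A - E) \<le> cmod (A - B) + cmod (B - D) + cmod (D - F) + cmod (F - E)" for A B D E F
      using norm_triangle_ineq[of "A - B" "B - D"] norm_triangle_ineq[of "A - D" "D - F"]
        norm_triangle_ineq[of "A - F" "F - E"] by simp
    have "C * (\<epsilon> + 1 / sqrt n) \<ge> 16 * r * \<bar>t\<bar> * \<epsilon> + 2 ^ r * exp \<bar>t\<bar> * (1 / sqrt n)
        + \<epsilon> * (\<bar>t\<bar> ^ 3 + t ^ 4 + t\<^sup>2) + 4 * r * t\<^sup>2 * \<epsilon>"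
    proof -
      define X1 X2 X3 X4 where X: "X1 = 16 * r * \<bar>t\<bar>" "X2 = 2 ^ r * exp \<bar>t\<bar>" "X3 = \<bar>t\<bar> ^ 3 + t ^ 4 + t\<^sup>2" "X4 = 4 * r * t\<^sup>2"
      define s where "s = 1 / sqrt n"
      have "X1 \<ge> 0" "X2 \<ge> 0" "X3 \<ge> 0" "X4 \<ge> 0" "s \<ge> 0" by (auto simp: X s_def)
      then have "0 \<le> X1 * s + X2 * \<epsilon> + X3 * s + X4 * s" using \<epsilon> by simp
      then have "X1 * \<epsilon> + X2 * s + \<epsilon> * X3 + X4 * \<epsilon> \<le> (X1 + X2 + X3 + X4) * (\<epsilon> + s)"
        by (simp add: algebra_simps)
      then show ?thesis unfolding C_def X s_def .
    qed
    with 1 2 3 4 5 tri[of "(\<Sum>m\<in>{1..n}. iexp (t * prime_sum a n m)) /\<^sub>R n" "complex_of_real (exp (- (t\<^sup>2 / 2)))"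
        "(\<Sum>m\<in>{1..n}. iexp (t * prime_sum a y m)) /\<^sub>R n" ?mod "complex_of_real (exp (- (t\<^sup>2 / 2 * Vy)))"]
    show "cmod ((\<Sum>m\<in>{1..n}. iexp (t * prime_sum a n m)) /\<^sub>R n - complex_of_real (exp (- (t\<^sup>2 / 2))))
      \<le> C * (\<epsilon> + 1 / sqrt n) + 4 * exp (4 * t\<^sup>2 * exp (2 * \<bar>t\<bar>)) / 2 ^ r"
      by linarith
  qed
qed

subsection \<open>Additive functions and prime powers\<close>

lemma additive_arith_1: "additive_arith F \<Longrightarrow> F 1 = 0"
  unfolding additive_arith_def by (metis add_cancel_right_right coprime_1_right mult.right_neutral zero_less_one)

lemma additive_arith_prod:
  assumes "additive_arith F" "finite I"
    and "\<And>i. i \<in> I \<Longrightarrow> 0 < x i" "\<And>i j. i \<in> I \<Longrightarrow> j \<in> I \<Longrightarrow> i \<noteq> j \<Longrightarrow> coprime (x i) (x j)"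
  shows "F (\<Prod>i\<in>I. x i) = (\<Sum>i\<in>I. F (x i))"
  using assms(2-)
proof (induction I rule: finite_induct)
  case empty
  then show ?case using additive_arith_1[OF assms(1)] by simp
next
  case (insert i I)
  have "coprime (x i) (\<Prod>i\<in>I. x i)"
    using insert.hyps insert.prems(2) by (intro prod_coprime_right) auto
  moreover have "0 < x i" "0 < (\<Prod>i\<in>I. x i)" using insert.prems(1) by (auto intro!: prod_pos)
  ultimately have "F (x i * (\<Prod>i\<in>I. x i)) = F (x i) + F (\<Prod>i\<in>I. x i)"
    using assms(1) by (auto simp: additive_arith_def)
  with insert show ?case by simp
qed

lemma additive_arith_prime_factors:
  assumes "additive_arith F" "m > 0"
  shows "F m = (\<Sum>p\<in>prime_factors m. F (p ^ multiplicity p m))"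
proof -
  have "m = (\<Prod>p\<in>prime_factors m. p ^ multiplicity p m)"
    using assms(2) by (rule prime_factorization_nat)
  moreover have "F (\<Prod>p\<in>prime_factors m. p ^ multiplicity p m) = (\<Sum>p\<in>prime_factors m. F (p ^ multiplicity p m))"
    using assms(1)
  proof (rule additive_arith_prod)
    show "0 < p ^ multiplicity p m" if "p \<in> prime_factors m" for p
      using that by (auto simp: in_prime_factors_iff prime_gt_0_nat)
    show "coprime (p ^ multiplicity p m) (q ^ multiplicity q m)"
      if "p \<in> prime_factors m" "q \<in> prime_factors m" "p \<noteq> q" for p q
      using that by (intro coprime_power_left_iff[THEN iffD2] coprime_power_right_iff[THEN iffD2] disjI1)
        (simp add: in_prime_factors_iff primes_coprime)
  qed simp
  ultimately show ?thesis by simp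
qed

text \<open>The exceptional set. Outside it a prime above \<open>Q\<close> divides m at most once
  and a prime up to \<open>Q\<close> has exponent below \<open>Q\<close>, so an additive function
  deviates from its strongly additive counterpart only through finitely many prime powers fixed by
  \<open>Q\<close>.\<close>

definition highly_divisible :: "nat \<Rightarrow> nat \<Rightarrow> nat set" where
  "highly_divisible n Q = {m\<in>{1..n}. (\<exists>p. prime p \<and> Q < p \<and> p\<^sup>2 dvd m) \<or> (\<exists>p. prime p \<and> p \<le> Q \<and> p ^ Q dvd m)}"

text \<open>A union bound, uniform in n: the squares contribute a tail of the sum of 1 / k^2, and
  each of the at most \<open>Q\<close> small primes contributes p^(-Q) \<le> 2^(-Q).\<close>

lemma highly_divisible_density:
  assumes "n > 0" "Q > 0"
  shows "card (highly_divisible n Q) / n \<le> 1 / Q + Q / 2 ^ Q"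
proof -
  let ?A = "\<lambda>d. {m\<in>{1..n}. d dvd m}"
  have "highly_divisible n Q \<subseteq> (\<Union>p\<in>{Q<..n}. ?A (p\<^sup>2)) \<union> (\<Union>p\<in>primes_upto Q. ?A (p ^ Q))"
  proof
    fix m assume m: "m \<in> highly_divisible n Q"
    then have m1: "m \<in> {1..n}" by (simp add: highly_divisible_def)
    consider p where "prime p" "Q < p" "p\<^sup>2 dvd m" | p where "prime p" "p \<le> Q" "p ^ Q dvd m"
      using m unfolding highly_divisible_def by blast
    then show "m \<in> (\<Union>p\<in>{Q<..n}. ?A (p\<^sup>2)) \<union> (\<Union>p\<in>primes_upto Q. ?A (p ^ Q))"
    proof cases
      case 1
      have "p \<le> p\<^sup>2" by (simp add: power2_nat_le_imp_le)
      also have "\<dots> \<le> m" using 1(3) m1 by (intro dvd_imp_le) auto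
      finally have "p \<le> n" using m1 by simp
      with 1 m1 show ?thesis by auto
    next
      case 2
      with m1 show ?thesis by (auto simp: primes_upto_def)
    qed
  qed
  then have "card (highly_divisible n Q) \<le> card ((\<Union>p\<in>{Q<..n}. ?A (p\<^sup>2)) \<union> (\<Union>p\<in>primes_upto Q. ?A (p ^ Q)))"
    by (intro card_mono) auto
  also have "\<dots> \<le> card (\<Union>p\<in>{Q<..n}. ?A (p\<^sup>2)) + card (\<Union>p\<in>primes_upto Q. ?A (p ^ Q))"
    by (rule card_Un_le)
  also have "\<dots> \<le> (\<Sum>p\<in>{Q<..n}. card (?A (p\<^sup>2))) + (\<Sum>p\<in>primes_upto Q. card (?A (p ^ Q)))"
    by (intro add_mono card_UN_le) auto
  finally have "real (card (highly_divisible n Q))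
      \<le> real ((\<Sum>p\<in>{Q<..n}. card (?A (p\<^sup>2))) + (\<Sum>p\<in>primes_upto Q. card (?A (p ^ Q))))"
    by (rule of_nat_mono)
  then have "card (highly_divisible n Q) / n
      \<le> (\<Sum>p\<in>{Q<..n}. card (?A (p\<^sup>2)) / n) + (\<Sum>p\<in>primes_upto Q. card (?A (p ^ Q)) / n)"
    unfolding sum_divide_distrib[symmetric] add_divide_distrib[symmetric] by (intro divide_right_mono) auto
  also have "\<dots> \<le> (\<Sum>p\<in>{Q<..n}. 1 / (real p)\<^sup>2) + (\<Sum>p\<in>primes_upto Q. 1 / 2 ^ Q)"
  proof (intro add_mono sum_mono)
    fix p assume "p \<in> {Q<..n}"
    then have "p\<^sup>2 > 0" by simp
    from density_multiples(1)[OF this \<open>n > 0\<close>] show "card (?A (p\<^sup>2)) / n \<le> 1 / (real p)\<^sup>2" by simp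
  next
    fix p assume p: "p \<in> primes_upto Q"
    then have "p ^ Q > 0" by (simp add: primes_upto_def prime_gt_0_nat)
    from density_multiples(1)[OF this \<open>n > 0\<close>] have "card (?A (p ^ Q)) / n \<le> 1 / real p ^ Q" by simp
    also have "\<dots> \<le> 1 / 2 ^ Q"
      using p by (intro divide_left_mono power_mono) (auto simp: primes_upto_def prime_ge_2_nat prime_gt_0_nat)
    finally show "card (?A (p ^ Q)) / n \<le> 1 / 2 ^ Q" .
  qed
  also have "\<dots> \<le> 1 / Q + Q / 2 ^ Q"
    using sum_inverse_squares_le[OF \<open>Q > 0\<close>, of n] card_primes_upto_le[of Q]
    by (intro add_mono) (simp_all add: divide_right_mono)
  finally show ?thesis .
qed

text \<open>Prime divisors of m above \<open>Q\<close> cancel, since their multiplicity is exactly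
  1. The right-hand side overcounts, running over all p and k up to \<open>Q\<close>, so as not to
  depend on m or n: it is a finite sum of values at fixed arguments, each negligible against
  \<open>dev_B\<close> when \<open>F\<close> is \<open>f n\<close>.\<close>

lemma additive_arith_approx:
  assumes "additive_arith F" "m \<in> {1..n}" "m \<notin> highly_divisible n Q"
  shows "\<bar>F m - (\<Sum>p\<in>primes_upto n. F p * of_bool (p dvd m))\<bar>
    \<le> (\<Sum>p\<in>{1..Q}. \<Sum>k\<in>{..Q}. \<bar>F (p ^ k)\<bar> + \<bar>F p\<bar>)"
proof -
  have "m > 0" using assms by simp
  have "(\<Sum>p\<in>primes_upto n. F p * of_bool (p dvd m)) = (\<Sum>p\<in>prime_factors m. F p)"
  proof (rule sum.mono_neutral_cong_right)
    show "prime_factors m \<subseteq> primes_upto n"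
      using assms(2) by (auto simp: primes_upto_def in_prime_factors_iff intro: order_trans[OF dvd_imp_le])
    show "\<forall>p\<in>primes_upto n - prime_factors m. F p * of_bool (p dvd m) = 0"
      using \<open>m > 0\<close> by (auto simp: primes_upto_def in_prime_factors_iff)
  qed (auto simp: in_prime_factors_iff)
  then have "\<bar>F m - (\<Sum>p\<in>primes_upto n. F p * of_bool (p dvd m))\<bar>
      = \<bar>\<Sum>p\<in>prime_factors m. F (p ^ multiplicity p m) - F p\<bar>"
    using additive_arith_prime_factors[OF assms(1) \<open>m > 0\<close>] by (simp add: sum_subtractf)
  also have "\<dots> \<le> (\<Sum>p\<in>prime_factors m. \<bar>F (p ^ multiplicity p m) - F p\<bar>)"
    by (rule sum_abs)
  also have "\<dots> = (\<Sum>p\<in>prime_factors m \<inter> {1..Q}. \<bar>F (p ^ multiplicity p m) - F p\<bar>)"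
  proof (rule sum.mono_neutral_right)
    show "\<forall>p\<in>prime_factors m - prime_factors m \<inter> {1..Q}. \<bar>F (p ^ multiplicity p m) - F p\<bar> = 0"
    proof
      fix p assume p: "p \<in> prime_factors m - prime_factors m \<inter> {1..Q}"
      then have "prime p" "p dvd m" by auto
      moreover have "Q < p" using p prime_gt_0_nat[OF \<open>prime p\<close>] by auto
      ultimately have "\<not> p\<^sup>2 dvd m" using assms(2,3) by (auto simp: highly_divisible_def)
      then have "multiplicity p m < 2" by (metis multiplicity_dvd' not_less)
      moreover have "multiplicity p m > 0"
        using \<open>prime p\<close> \<open>p dvd m\<close> \<open>m > 0\<close> by (simp add: prime_multiplicity_gt_zero_iff)
      ultimately have "multiplicity p m = 1" by simp
      then show "\<bar>F (p ^ multiplicity p m) - F p\<bar> = 0" by simp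
    qed
  qed auto
  also have "\<dots> \<le> (\<Sum>p\<in>prime_factors m \<inter> {1..Q}. \<Sum>k\<in>{..Q}. \<bar>F (p ^ k)\<bar> + \<bar>F p\<bar>)"
  proof (rule sum_mono)
    fix p assume p: "p \<in> prime_factors m \<inter> {1..Q}"
    then have "\<not> p ^ Q dvd m" using assms(2,3) by (auto simp: highly_divisible_def)
    then have "multiplicity p m \<le> Q" by (metis multiplicity_dvd' nat_le_linear)
    then have "(\<Sum>k\<in>{multiplicity p m}. \<bar>F (p ^ k)\<bar> + \<bar>F p\<bar>) \<le> (\<Sum>k\<in>{..Q}. \<bar>F (p ^ k)\<bar> + \<bar>F p\<bar>)"
      by (intro sum_mono2) auto
    moreover have "\<bar>F (p ^ multiplicity p m) - F p\<bar> \<le> \<bar>F (p ^ multiplicity p m)\<bar> + \<bar>F p\<bar>"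
      by (rule abs_triangle_ineq4)
    ultimately show "\<bar>F (p ^ multiplicity p m) - F p\<bar> \<le> (\<Sum>k\<in>{..Q}. \<bar>F (p ^ k)\<bar> + \<bar>F p\<bar>)" by simp
  qed
  also have "\<dots> \<le> (\<Sum>p\<in>{1..Q}. \<Sum>k\<in>{..Q}. \<bar>F (p ^ k)\<bar> + \<bar>F p\<bar>)"
    by (intro sum_mono2) (auto intro!: sum_nonneg)
  finally show ?thesis .
qed

text \<open>Lipschitz continuity off \<open>N\<close>, the trivial bound 2 on it: closeness in
  probability is enough for characteristic functions, whatever the size of the difference on
  \<open>N\<close>.\<close>

lemma cmod_average_iexp_diff_off_set:
  fixes n :: nat
  assumes "n > 0" "N \<subseteq> {1..n}" "0 \<le> \<eta>" and close: "\<And>m. m \<in> {1..n} - N \<Longrightarrow> \<bar>x m - y m\<bar> \<le> \<eta>"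
  shows "cmod ((\<Sum>m\<in>{1..n}. iexp (t * x m)) /\<^sub>R n - (\<Sum>m\<in>{1..n}. iexp (t * y m)) /\<^sub>R n)
    \<le> \<bar>t\<bar> * \<eta> + 2 * (card N / n)"
proof -
  have fin: "finite N" using assms(2) finite_subset by auto
  have "cmod ((\<Sum>m\<in>{1..n}. iexp (t * x m)) /\<^sub>R n - (\<Sum>m\<in>{1..n}. iexp (t * y m)) /\<^sub>R n)
      = cmod (\<Sum>m\<in>{1..n}. iexp (t * x m) - iexp (t * y m)) / n"
    by (simp add: scaleR_diff_right[symmetric] sum_subtractf divide_inverse mult.commute)
  also have "\<dots> \<le> (\<Sum>m\<in>{1..n}. \<bar>t\<bar> * \<eta> + 2 * of_bool (m \<in> N)) / n"
  proof (intro divide_right_mono order_trans[OF norm_sum] sum_mono)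
    fix m assume m: "m \<in> {1..n}"
    show "cmod (iexp (t * x m) - iexp (t * y m)) \<le> \<bar>t\<bar> * \<eta> + 2 * of_bool (m \<in> N)"
    proof (cases "m \<in> N")
      case True
      have "cmod (iexp (t * x m) - iexp (t * y m)) \<le> cmod (iexp (t * x m)) + cmod (iexp (t * y m))"
        by (rule norm_triangle_ineq4)
      also have "\<dots> = 2" by simp
      also have "2 \<le> \<bar>t\<bar> * \<eta> + 2 * of_bool (m \<in> N)" using True assms by simp
      finally show ?thesis .
    next
      case False
      have "cmod (iexp (t * x m) - iexp (t * y m)) \<le> \<bar>t * x m - t * y m\<bar>" by (rule cmod_iexp_diff_le)
      also have "\<dots> = \<bar>t\<bar> * \<bar>x m - y m\<bar>" by (simp add: abs_mult[symmetric] algebra_simps)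
      also have "\<dots> \<le> \<bar>t\<bar> * \<eta>" using False m close by (intro mult_left_mono) auto
      finally show ?thesis using False by simp
    qed
  qed simp
  also have "\<dots> = \<bar>t\<bar> * \<eta> + 2 * (card N / n)"
  proof -
    have "{1..n} \<inter> {m. m \<in> N} = N" using assms(2) by auto
    then show ?thesis using \<open>n > 0\<close>
      by (simp add: sum.distrib sum_distrib_left[symmetric] sum_of_bool_eq add_divide_distrib
          )
  qed
  finally show ?thesis .
qed

subsection \<open>Convergence in distribution\<close>

lemma isCont_Phi: "isCont Phi x"
proof -
  interpret real_distribution std_normal_distribution by (rule real_dist_normal_dist)
  have "emeasure std_normal_distribution {x} = 0"
    by (subst emeasure_density) auto
  then have "measure std_normal_distribution {x} = 0" by (simp add: measure_def)
  then show ?thesis unfolding Phi_def by (simp add: isCont_cdf)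
qed

lemma unif_prob_eq: "unif_prob n S = card {m\<in>{1..n}. m \<in> S} / n" if "n > 0"
  using that by (simp add: unif_prob_def measure_pmf_of_set Int_def)

lemma unif_prob_tendsto_Phi:
  assumes "\<And>t. (\<lambda>n. (\<Sum>m\<in>{1..n}. iexp (t * T n m)) /\<^sub>R n) \<longlonglongrightarrow> complex_of_real (exp (- (t\<^sup>2 / 2)))"
  shows "(\<lambda>n. unif_prob n {m. T n m \<le> x}) \<longlonglongrightarrow> Phi x"
proof -
  define M where "M n = distr (measure_pmf (pmf_of_set {1..n})) borel (T n)" for n
  have rd: "real_distribution (M n)" for n
    unfolding M_def by (rule prob_space.real_distribution_distr) (auto intro: measure_pmf.prob_space_axioms)
  have char: "char (M n) t = (\<Sum>m\<in>{1..n}. iexp (t * T n m)) /\<^sub>R n" if "n > 0" for n t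
  proof -
    have "char (M n) t = (CLINT m | measure_pmf (pmf_of_set {1..n}). iexp (t * T n m))"
      unfolding char_def M_def by (rule integral_distr) auto
    also have "\<dots> = (\<Sum>m\<in>{1..n}. iexp (t * T n m)) /\<^sub>R n"
      using that by (subst integral_measure_pmf[of "{1..n}"]) (auto simp: scaleR_sum_right divide_inverse)
    finally show ?thesis .
  qed
  have "weak_conv_m M std_normal_distribution"
  proof (rule levy_continuity[OF rd real_dist_normal_dist])
    fix t
    \<comment> \<open>\<open>pmf_of_set\<close> is unspecified on the empty set, so the formula for
      \<open>char\<close> is available only for n > 0.\<close>
    have "\<forall>\<^sub>F n in sequentially. (\<Sum>m\<in>{1..n}. iexp (t * T n m)) /\<^sub>R n = char (M n) t"
      using eventually_gt_at_top[of 0] by eventually_elim (simp add: char)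
    with assms[of t] have "(\<lambda>n. char (M n) t) \<longlonglongrightarrow> complex_of_real (exp (- (t\<^sup>2 / 2)))"
      by (rule Lim_transform_eventually)
    then show "(\<lambda>n. char (M n) t) \<longlonglongrightarrow> char std_normal_distribution t"
      by (simp only: char_std_normal_distribution minus_divide_left)
  qed
  moreover have "isCont (cdf std_normal_distribution) x"
    using isCont_Phi unfolding Phi_def .
  ultimately have "(\<lambda>n. cdf (M n) x) \<longlonglongrightarrow> cdf std_normal_distribution x"
    by (simp add: weak_conv_m_def weak_conv_def)
  moreover have "cdf (M n) x = unif_prob n {m. T n m \<le> x}" for n
    by (simp add: cdf_def M_def measure_distr unif_prob_def vimage_def)
  ultimately show ?thesis by (simp add: Phi_def)
qed

section \<open>The central limit theorem for normalized additive functions\<close>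

lemma dev_B_squared: "(dev_B f n)\<^sup>2 = (\<Sum>p\<in>primes_upto n. (f n p)\<^sup>2 / real p)"
  unfolding dev_B_def by (intro real_sqrt_pow2 sum_nonneg) auto

text \<open>The order of choices: the Taylor order from the target accuracy, \<open>Q\<close> for
  the exceptional set, \<open>C\<close> depending on the Taylor order, and finally n. Each of the
  four error contributions gets a quarter of \<open>e\<close>.\<close>

lemma additive_char_tendsto:
  fixes f :: "nat \<Rightarrow> nat \<Rightarrow> real"
  assumes add: "\<And>n. n \<ge> 1 \<Longrightarrow> additive_arith (f n)"
    and B: "\<And>n. n \<ge> n0 \<Longrightarrow> dev_B f n > 0"
    and pointwise: "\<And>m. m \<ge> 1 \<Longrightarrow> (\<lambda>n. f n m / dev_B f n) \<longlonglongrightarrow> 0"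
    and maximum: "(\<lambda>n. Max ((\<lambda>p. \<bar>f n p\<bar>) ` primes_upto n) / dev_B f n) \<longlonglongrightarrow> 0"
  shows "(\<lambda>n. (\<Sum>m\<in>{1..n}. iexp (t * ((f n m - mean_A f n) / dev_B f n))) /\<^sub>R n)
    \<longlonglongrightarrow> complex_of_real (exp (- (t\<^sup>2 / 2)))"
proof (rule LIM_zero_cancel, rule tendsto_norm_zero_cancel)
  define \<epsilon> where "\<epsilon> n = Max ((\<lambda>p. \<bar>f n p\<bar>) ` primes_upto n) / dev_B f n" for n
  define a where "a n p = f n p / dev_B f n" for n p
  define T where "T n m = (f n m - mean_A f n) / dev_B f n" for n m
  define E where "E x n = (\<Sum>m\<in>{1..n}. iexp (t * x n m)) /\<^sub>R n" for x :: "nat \<Rightarrow> nat \<Rightarrow> real" and n :: nat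
  define D where "D Q n = (\<Sum>p\<in>{1..Q}. \<Sum>k\<in>{..Q}. \<bar>f n (p ^ k)\<bar> + \<bar>f n p\<bar>) / dev_B f n" for Q n
  have a_le: "\<bar>a n p\<bar> \<le> \<epsilon> n" if "n \<ge> n0" "p \<in> primes_upto n" for n p
  proof -
    have "\<bar>f n p\<bar> \<le> Max ((\<lambda>p. \<bar>f n p\<bar>) ` primes_upto n)" using that by (intro Max_ge) auto
    then show ?thesis using B[OF that(1)] by (simp add: a_def \<epsilon>_def divide_right_mono)
  qed
  have V: "(\<Sum>p\<in>primes_upto n. (a n p)\<^sup>2 / real p) = 1" if "n \<ge> n0" for n
  proof -
    have "(\<Sum>p\<in>primes_upto n. (a n p)\<^sup>2 / real p) = (\<Sum>p\<in>primes_upto n. (f n p)\<^sup>2 / real p) / (dev_B f n)\<^sup>2"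
      by (simp add: a_def power_divide sum_divide_distrib mult.commute)
    then show ?thesis using B[OF that] by (simp add: dev_B_squared[symmetric])
  qed
  have close: "\<bar>T n m - prime_sum (a n) n m\<bar> \<le> D Q n"
    if "n \<ge> n0" "m \<in> {1..n} - highly_divisible n Q" for n m Q
  proof -
    \<comment> \<open>The centring constants of \<open>prime_sum\<close> add up to exactly
      \<open>mean_A f n / dev_B f n\<close> and cancel.\<close>
    have "T n m - prime_sum (a n) n m = (f n m - (\<Sum>p\<in>primes_upto n. f n p * of_bool (p dvd m))) / dev_B f n"
      unfolding T_def prime_sum_def a_def mean_A_def diff_divide_distrib sum_divide_distrib
        right_diff_distrib sum_subtractf by (simp only: mult_1_right times_divide_eq_left times_divide_eq_right divide_divide_eq_left mult.commute) simp
    moreover have "\<bar>f n m - (\<Sum>p\<in>primes_upto n. f n p * of_bool (p dvd m))\<bar>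
        \<le> (\<Sum>p\<in>{1..Q}. \<Sum>k\<in>{..Q}. \<bar>f n (p ^ k)\<bar> + \<bar>f n p\<bar>)"
      using that add by (intro additive_arith_approx) auto
    ultimately show ?thesis using B[OF that(1)] by (simp add: D_def divide_right_mono)
  qed
  have D_lim: "D Q \<longlonglongrightarrow> 0" for Q
  proof -
    have "(\<lambda>n. \<Sum>p\<in>{1..Q}. \<Sum>k\<in>{..Q}. \<bar>f n (p ^ k) / dev_B f n\<bar> + \<bar>f n p / dev_B f n\<bar>)
        \<longlonglongrightarrow> (\<Sum>p\<in>{1..Q}. \<Sum>k\<in>{..Q}. \<bar>0\<bar> + \<bar>0\<bar>)"
      by (intro tendsto_sum tendsto_add tendsto_rabs pointwise) auto
    moreover have "\<forall>\<^sub>F n in sequentially. (\<Sum>p\<in>{1..Q}. \<Sum>k\<in>{..Q}. \<bar>f n (p ^ k) / dev_B f n\<bar> + \<bar>f n p / dev_B f n\<bar>) = D Q n"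
      using eventually_ge_at_top[of n0]
    proof eventually_elim
      case (elim n)
      then show ?case using B[of n] by (simp add: D_def sum_divide_distrib add_divide_distrib)
    qed
    ultimately show ?thesis using Lim_transform_eventually by fastforce
  qed
  show "(\<lambda>n. norm ((\<Sum>m\<in>{1..n}. iexp (t * ((f n m - mean_A f n) / dev_B f n))) /\<^sub>R n
      - complex_of_real (exp (- (t\<^sup>2 / 2))))) \<longlonglongrightarrow> 0"
    unfolding T_def[symmetric]
  proof (rule LIMSEQ_I)
    fix e :: real assume "e > 0"
    let ?G = "4 * exp (4 * t\<^sup>2 * exp (2 * \<bar>t\<bar>))"
    \<comment> \<open>The Taylor order is taken as 2 (k + 1), hence even and positive.\<close>
    have "(\<lambda>k. ?G / 2 ^ (2 * Suc k)) \<longlonglongrightarrow> 0" by real_asymp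
    then have "\<forall>\<^sub>F k in sequentially. ?G / 2 ^ (2 * Suc k) < e / 4"
      using \<open>e > 0\<close> by (intro order_tendstoD(2)[where y = 0]) auto
    then obtain k where k: "?G / 2 ^ (2 * Suc k) < e / 4"
      by (auto simp: eventually_sequentially)
    have "(\<lambda>Q. 2 * (1 / real Q + real Q / 2 ^ Q)) \<longlonglongrightarrow> 0" by real_asymp
    then have "\<forall>\<^sub>F Q in sequentially. 2 * (1 / real Q + real Q / 2 ^ Q) < e / 4 \<and> Q > 0"
      using \<open>e > 0\<close> by (intro eventually_conj order_tendstoD(2)[where y = 0] eventually_gt_at_top) auto
    then obtain Q where Q: "2 * (1 / real Q + real Q / 2 ^ Q) < e / 4" "Q > 0"
      by (auto simp: eventually_sequentially)
    have "even (2 * Suc k)" "0 < 2 * Suc k" by simp_all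
    from prime_sum_char_bound[OF this, of t] obtain C where
      "\<forall>n a \<epsilon>. 2 ^ (2 * (2 * Suc k)) \<le> n \<longrightarrow> 0 \<le> \<epsilon> \<longrightarrow> \<epsilon> \<le> 1 \<longrightarrow>
        (\<forall>p\<in>primes_upto n. \<bar>a p\<bar> \<le> \<epsilon>) \<longrightarrow> (\<Sum>p\<in>primes_upto n. (a p)\<^sup>2 / real p) = 1 \<longrightarrow>
        cmod ((\<Sum>m\<in>{1..n}. iexp (t * prime_sum a n m)) /\<^sub>R n - complex_of_real (exp (- (t\<^sup>2 / 2))))
          \<le> C * (\<epsilon> + 1 / sqrt n) + ?G / 2 ^ (2 * Suc k)"
      by (rule exE)
    note C = this[rule_format]
    have "(\<lambda>n. 1 / sqrt (real n)) \<longlonglongrightarrow> 0" by real_asymp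
    with maximum have "(\<lambda>n. C * (\<epsilon> n + 1 / sqrt n)) \<longlonglongrightarrow> C * (0 + 0)"
      unfolding \<epsilon>_def by (intro tendsto_mult tendsto_add tendsto_const)
    then have 1: "\<forall>\<^sub>F n in sequentially. C * (\<epsilon> n + 1 / sqrt n) < e / 4"
      using \<open>e > 0\<close> by (intro order_tendstoD(2)[where y = 0]) auto
    have "(\<lambda>n. \<bar>t\<bar> * D Q n) \<longlonglongrightarrow> \<bar>t\<bar> * 0" by (intro tendsto_mult tendsto_const D_lim)
    then have 2: "\<forall>\<^sub>F n in sequentially. \<bar>t\<bar> * D Q n < e / 4"
      using \<open>e > 0\<close> by (intro order_tendstoD(2)[where y = 0]) auto
    have 3: "\<forall>\<^sub>F n in sequentially. \<epsilon> n < 1"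
      using maximum unfolding \<epsilon>_def by (intro order_tendstoD(2)[where y = 0]) auto
    have "\<forall>\<^sub>F n in sequentially. norm (norm (E T n - complex_of_real (exp (- (t\<^sup>2 / 2)))) - 0) < e"
      using 1 2 3 eventually_ge_at_top[of n0] eventually_ge_at_top[of "2 ^ (2 * (2 * Suc k))"]
        eventually_ge_at_top[of 2]
    proof eventually_elim
      case (elim n)
      \<comment> \<open>The prime 2 witnesses that \<open>\<epsilon> n\<close> is nonnegative: the
        maximum dominates |f n 2|.\<close>
      have "2 \<in> primes_upto n" using elim by (simp add: primes_upto_def)
      then have "0 \<le> \<epsilon> n" using a_le[OF \<open>n \<ge> n0\<close>, of 2] by linarith
      have "cmod (E (\<lambda>n. prime_sum (a n) n) n - complex_of_real (exp (- (t\<^sup>2 / 2))))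
          \<le> C * (\<epsilon> n + 1 / sqrt n) + ?G / 2 ^ (2 * Suc k)"
        unfolding E_def using elim \<open>0 \<le> \<epsilon> n\<close> a_le V by (intro C) auto
      moreover have "cmod (E T n - E (\<lambda>n. prime_sum (a n) n) n)
          \<le> \<bar>t\<bar> * D Q n + 2 * (card (highly_divisible n Q) / n)"
        unfolding E_def using elim B[of n] close
        by (intro cmod_average_iexp_diff_off_set)
          (auto simp: highly_divisible_def D_def intro!: divide_nonneg_pos sum_nonneg)
      moreover have "2 * (card (highly_divisible n Q) / n) \<le> 2 * (1 / Q + Q / 2 ^ Q)"
        using highly_divisible_density[of n Q] elim Q(2) by (intro mult_left_mono) auto
      moreover have "cmod (E T n - complex_of_real (exp (- (t\<^sup>2 / 2))))
          \<le> cmod (E T n - E (\<lambda>n. prime_sum (a n) n) n)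
            + cmod (E (\<lambda>n. prime_sum (a n) n) n - complex_of_real (exp (- (t\<^sup>2 / 2))))"
        using norm_triangle_ineq[of "E T n - E (\<lambda>n. prime_sum (a n) n) n"
            "E (\<lambda>n. prime_sum (a n) n) n - complex_of_real (exp (- (t\<^sup>2 / 2)))"] by simp
      ultimately have "cmod (E T n - complex_of_real (exp (- (t\<^sup>2 / 2)))) < e"
        using elim(1,2) k Q(1) by linarith
      then show ?case by simp
    qed
    then show "\<exists>no. \<forall>n\<ge>no. norm (norm ((\<Sum>m\<in>{1..n}. iexp (t * T n m)) /\<^sub>R n
        - complex_of_real (exp (- (t\<^sup>2 / 2)))) - 0) < e"
      unfolding E_def by (simp only: eventually_sequentially)
  qed
qed

section \<open>Transfer of the limit law to the functions \<open>gn n\<close>\<close>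

lemma unif_prob_mono: "S \<subseteq> U \<Longrightarrow> unif_prob n S \<le> unif_prob n U"
  unfolding unif_prob_def by (rule measure_pmf.finite_measure_mono) auto

lemma unif_prob_Un_le: "unif_prob n (S \<union> U) \<le> unif_prob n S + unif_prob n U"
  unfolding unif_prob_def by (rule measure_Un_le) auto

lemma unif_prob_Compl: "unif_prob n (- S) = 1 - unif_prob n S"
  unfolding unif_prob_def using measure_pmf.prob_compl[of S "pmf_of_set {1..n}"]
  by (simp add: Compl_eq_Diff_UNIV)

text \<open>Off the bad set, T \<le> x - d implies h \<le> x, which implies T \<le> x + d;
  continuity of \<open>Phi\<close> at x closes the gap. Points outside \<open>M n\<close> count as
  bad, which takes care of \<open>h n\<close> being meaningful only on \<open>M n\<close>.\<close>

lemma slutsky_unif_prob: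
  assumes T: "\<And>x. (\<lambda>n. unif_prob n {m. T n m \<le> x}) \<longlonglongrightarrow> Phi x"
    and close: "\<And>e. e > 0 \<Longrightarrow> (\<lambda>n. unif_prob n {m. m \<notin> M n \<or> \<bar>h n m - T n m\<bar> > e}) \<longlonglongrightarrow> 0"
  shows "(\<lambda>n. unif_prob n {m\<in>M n. h n m \<le> x}) \<longlonglongrightarrow> Phi x"
proof (rule LIMSEQ_I)
  fix e :: real assume "e > 0"
  then obtain s where "s > 0" and s: "\<And>y. \<bar>y - x\<bar> < s \<Longrightarrow> \<bar>Phi y - Phi x\<bar> < e / 3"
    using isCont_Phi[of x] unfolding continuous_at_eps_delta dist_real_def
    by (meson divide_pos_pos zero_less_numeral)
  \<comment> \<open>Halving keeps x + d and x - d strictly within distance s of x.\<close>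
  define d where "d = s / 2"
  have d: "d > 0" "\<bar>Phi (x + d) - Phi x\<bar> < e / 3" "\<bar>Phi (x - d) - Phi x\<bar> < e / 3"
    using \<open>s > 0\<close> s[of "x + d"] s[of "x - d"] by (auto simp: d_def)
  define bad where "bad n = {m. m \<notin> M n \<or> \<bar>h n m - T n m\<bar> > d}" for n
  have "\<forall>\<^sub>F n in sequentially. \<bar>unif_prob n (bad n) - 0\<bar> < e / 3"
    using tendstoD[OF close[OF d(1)], of "e / 3"] \<open>e > 0\<close> by (simp add: bad_def dist_real_def)
  moreover have "\<forall>\<^sub>F n in sequentially. \<bar>unif_prob n {m. T n m \<le> y} - Phi y\<bar> < e / 3" for y
    using tendstoD[OF T, of "e / 3" y] \<open>e > 0\<close> by (simp add: dist_real_def)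
  ultimately have "\<forall>\<^sub>F n in sequentially. \<bar>unif_prob n (bad n) - 0\<bar> < e / 3 \<and>
      \<bar>unif_prob n {m. T n m \<le> x + d} - Phi (x + d)\<bar> < e / 3 \<and>
      \<bar>unif_prob n {m. T n m \<le> x - d} - Phi (x - d)\<bar> < e / 3"
    by (intro eventually_conj) auto
  then have "\<forall>\<^sub>F n in sequentially. norm (unif_prob n {m\<in>M n. h n m \<le> x} - Phi x) < e"
  proof eventually_elim
    case (elim n)
    have "unif_prob n {m\<in>M n. h n m \<le> x} \<le> unif_prob n ({m. T n m \<le> x + d} \<union> bad n)"
      by (rule unif_prob_mono) (auto simp: bad_def)
    also have "\<dots> \<le> unif_prob n {m. T n m \<le> x + d} + unif_prob n (bad n)" by (rule unif_prob_Un_le)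
    finally have 1: "unif_prob n {m\<in>M n. h n m \<le> x} \<le> \<dots>" .
    have "unif_prob n {m. T n m \<le> x - d} \<le> unif_prob n ({m\<in>M n. h n m \<le> x} \<union> bad n)"
      by (rule unif_prob_mono) (auto simp: bad_def)
    also have "\<dots> \<le> unif_prob n {m\<in>M n. h n m \<le> x} + unif_prob n (bad n)" by (rule unif_prob_Un_le)
    finally show ?case using 1 d elim unfolding real_norm_def by linarith
  qed
  then show "\<exists>no. \<forall>n\<ge>no. norm (unif_prob n {m\<in>M n. h n m \<le> x} - Phi x) < e"
    by (simp add: eventually_sequentially)
qed

text \<open>Only \<open>g\<close> is controlled near \<open>1\<close> by its derivative at \<open>1\<close>; the difference \<open>gn n - g\<close> is
  controlled by the mean value theorem. No continuity of \<open>g'\<close> is available.\<close>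

lemma uniform_linearization:
  fixes g g' :: "real \<Rightarrow> real" and gn gn' :: "nat \<Rightarrow> real \<Rightarrow> real"
  assumes "convex S" "c \<in> S" "\<kappa> > 0"
    and g: "\<And>x. x \<in> S \<Longrightarrow> (g has_real_derivative g' x) (at x within S)"
    and gn: "\<And>n x. n \<ge> 1 \<Longrightarrow> x \<in> S \<Longrightarrow> (gn n has_real_derivative gn' n x) (at x within S)"
    and unif: "uniform_limit S gn' g' sequentially"
  shows "\<exists>d>0. \<forall>\<^sub>F n in sequentially. \<forall>z\<in>S. \<bar>z - c\<bar> < d \<longrightarrow>
    \<bar>gn n z - gn n c - gn' n c * (z - c)\<bar> \<le> \<kappa> * \<bar>z - c\<bar>"
proof -
  obtain d where "d > 0" and d: "\<And>z. z \<in> S \<Longrightarrow> \<bar>z - c\<bar> < d \<Longrightarrow> \<bar>g z - g c - g' c * (z - c)\<bar> \<le> \<kappa> / 3 * \<bar>z - c\<bar>"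
  proof -
    have "\<kappa> / 3 > 0" using \<open>\<kappa> > 0\<close> by simp
    with g[OF \<open>c \<in> S\<close>] show ?thesis
      using that unfolding has_field_derivative_def has_derivative_within_alt real_norm_def by blast
  qed
  have "\<forall>\<^sub>F n in sequentially. \<forall>x\<in>S. \<bar>gn' n x - g' x\<bar> < \<kappa> / 3"
    using uniform_limitD[OF unif, of "\<kappa> / 3"] \<open>\<kappa> > 0\<close> by (simp add: dist_real_def)
  then have "\<forall>\<^sub>F n in sequentially. \<forall>z\<in>S. \<bar>z - c\<bar> < d \<longrightarrow>
      \<bar>gn n z - gn n c - gn' n c * (z - c)\<bar> \<le> \<kappa> * \<bar>z - c\<bar>"
    using eventually_ge_at_top[of 1]
  proof (eventually_elim, intro ballI impI)
    fix n z assume n: "\<forall>x\<in>S. \<bar>gn' n x - g' x\<bar> < \<kappa> / 3" "1 \<le> n" and z: "z \<in> S" "\<bar>z - c\<bar> < d"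
    have "norm ((gn n z - g z) - (gn n c - g c)) \<le> \<kappa> / 3 * norm (z - c)"
    proof (rule field_differentiable_bound[OF \<open>convex S\<close>])
      show "((\<lambda>x. gn n x - g x) has_field_derivative gn' n x - g' x) (at x within S)" if "x \<in> S" for x
        using g gn n(2) that by (intro derivative_intros) auto
      show "norm (gn' n x - g' x) \<le> \<kappa> / 3" if "x \<in> S" for x using n(1) that by (simp add: less_imp_le)
    qed (use z assms in auto)
    then have 1: "\<bar>(gn n z - g z) - (gn n c - g c)\<bar> \<le> \<kappa> / 3 * \<bar>z - c\<bar>" by simp
    have "\<bar>gn' n c - g' c\<bar> * \<bar>z - c\<bar> \<le> \<kappa> / 3 * \<bar>z - c\<bar>"
      using n(1) \<open>c \<in> S\<close> by (intro mult_right_mono) (auto intro: less_imp_le)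
    then have 2: "\<bar>(gn' n c - g' c) * (z - c)\<bar> \<le> \<kappa> / 3 * \<bar>z - c\<bar>" by (simp only: abs_mult)
    \<comment> \<open>Three errors of \<open>\<kappa> / 3\<close> each: the mean value bound for gn
      n - g, differentiability of g at c, and convergence of the derivatives at c.\<close>
    have "gn n z - gn n c - gn' n c * (z - c) =
        ((gn n z - g z) - (gn n c - g c)) + (g z - g c - g' c * (z - c)) - (gn' n c - g' c) * (z - c)"
      by (simp add: algebra_simps)
    with 1 2 d[OF z] show "\<bar>gn n z - gn n c - gn' n c * (z - c)\<bar> \<le> \<kappa> * \<bar>z - c\<bar>" by linarith
  qed
  with \<open>d > 0\<close> show ?thesis by blast
qed

text \<open>Tightness of the limit law: it confines the normalized values to a fixed interval
  [- K, K] up to small probability, where f n / A n is within K B n / |A n| of 1.\<close>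

lemma Phi_tail: "\<exists>K>0. 1 - Phi K + Phi (- K) < \<eta>" if "\<eta> > 0"
proof -
  interpret real_distribution std_normal_distribution by (rule real_dist_normal_dist)
  have "((\<lambda>K. 1 - Phi K + Phi (- K)) \<longlongrightarrow> 1 - 1 + 0) at_top"
    unfolding Phi_def
    by (intro tendsto_intros cdf_lim_at_top_prob
        filterlim_compose[OF cdf_lim_at_bot filterlim_uminus_at_bot_at_top])
  then have "\<forall>\<^sub>F K in at_top. 1 - Phi K + Phi (- K) < \<eta>"
    using that by (intro order_tendstoD(2)[where y = 0]) auto
  then have "\<forall>\<^sub>F K in at_top. 0 < K \<and> 1 - Phi K + Phi (- K) < \<eta>"
    by (intro eventually_conj eventually_gt_at_top)
  then show ?thesis by (auto simp: eventually_at_top_linorder)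
qed

text \<open>The complement of \<open>dom_set\<close> in the naturals also contains all m > n. These
  have probability 0 once n > 0, and the m < n0 have probability at most n0 / n.\<close>

lemma unif_prob_lessThan_tendsto: "(\<lambda>n. unif_prob n ({..<n0} \<union> {n<..})) \<longlonglongrightarrow> 0"
proof (rule tendsto_sandwich[OF _ _ tendsto_const])
  show "(\<lambda>n. real n0 / real n) \<longlonglongrightarrow> 0" by real_asymp
  show "\<forall>\<^sub>F n in sequentially. unif_prob n ({..<n0} \<union> {n<..}) \<le> real n0 / real n"
    using eventually_gt_at_top[of 0]
  proof eventually_elim
    case (elim n)
    have "card {m\<in>{1..n}. m \<in> {..<n0} \<union> {n<..}} \<le> card {..<n0}" by (intro card_mono) auto
    then show ?case using elim by (simp add: unif_prob_eq divide_right_mono)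
  qed
qed (simp add: unif_prob_def)

text \<open>With z = f n m / A n one has z - 1 = T (B n / A n), so for an affine \<open>gn n\<close>
  of nonzero slope the quotient is T itself. The sign of A n cancels because B n / A n also stands
  in the denominator. The general case adds a linearization error that is small wherever |T| \<le>
  K.\<close>

theorem theorem3:
  fixes f :: "nat \<Rightarrow> nat \<Rightarrow> real"
    and g g' :: "real \<Rightarrow> real"
    and gn gn' :: "nat \<Rightarrow> real \<Rightarrow> real"
    and \<delta> :: real and n0 :: nat
  assumes "\<And>n. n \<ge> 1 \<Longrightarrow> additive_arith (f n)"
    and "\<And>n. n \<ge> n0 \<Longrightarrow> mean_A f n \<noteq> 0"
    and "\<And>n. n \<ge> n0 \<Longrightarrow> dev_B f n > 0"
    and "\<And>m. m \<ge> 1 \<Longrightarrow> (\<lambda>n. f n m / dev_B f n) \<longlonglongrightarrow> 0"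
    and "(\<lambda>n. Max ((\<lambda>p. \<bar>f n p\<bar>) ` primes_upto n) / dev_B f n) \<longlonglongrightarrow> 0"
    and "filterlim (\<lambda>n. \<bar>mean_A f n\<bar> / dev_B f n) at_top sequentially"
    and "\<delta> > 0"
    and "\<And>x. x \<in> {1 - \<delta>..1 + \<delta>} \<Longrightarrow>
           (g has_real_derivative g' x) (at x within {1 - \<delta>..1 + \<delta>})"
    and "g' 1 \<noteq> 0"
    and "\<And>n x. n \<ge> 1 \<Longrightarrow> x \<in> {1 - \<delta>..1 + \<delta>} \<Longrightarrow>
           (gn n has_real_derivative gn' n x) (at x within {1 - \<delta>..1 + \<delta>})"
    and "uniform_limit {1 - \<delta>..1 + \<delta>} gn' g' sequentially"
    and "(\<lambda>n. gn n 1) \<longlonglongrightarrow> g 1"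
  shows "conv_Phi (dom_set f n0 \<delta>)
           (\<lambda>n m. (gn n (f n m / mean_A f n) - gn n 1) / (gn' n 1 * (dev_B f n / mean_A f n)))"
proof -
  let ?S = "{1 - \<delta>..1 + \<delta>}" and ?M = "dom_set f n0 \<delta>"
  let ?A = "mean_A f" and ?B = "dev_B f"
  define T where "T n m = (f n m - ?A n) / ?B n" for n m
  define h where "h n m = (gn n (f n m / ?A n) - gn n 1) / (gn' n 1 * (?B n / ?A n))" for n m
  have T: "(\<lambda>n. unif_prob n {m. T n m \<le> x}) \<longlonglongrightarrow> Phi x" for x
    unfolding T_def using assms(1,3,4,5) by (intro unif_prob_tendsto_Phi additive_char_tendsto)
  have "1 \<in> ?S" using \<open>\<delta> > 0\<close> by simp
  have ratio: "(\<lambda>n. ?B n / \<bar>?A n\<bar>) \<longlonglongrightarrow> 0"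
    using tendsto_inverse_0_at_top[OF assms(6)] by (simp add: inverse_eq_divide)
  have gn'_lim: "(\<lambda>n. gn' n 1) \<longlonglongrightarrow> g' 1"
    using tendsto_uniform_limitI[OF assms(11) \<open>1 \<in> ?S\<close>] .

  \<comment> \<open>For large n both conclusions hold for all m with |T| \<le> K at once, so the
    same estimate yields the limit law and the full probability of the domain.\<close>
  have near: "\<forall>\<^sub>F n in sequentially. \<forall>m\<in>{n0..n}. \<bar>T n m\<bar> \<le> K \<longrightarrow> m \<in> ?M n \<and> \<bar>h n m - T n m\<bar> \<le> e"
    if "K > 0" "e > 0" for K e
  proof -
    \<comment> \<open>Chosen for the final bound: |gn' n 1| eventually exceeds |g' 1| / 2, and
      \<open>\<kappa> * K / (\<bar>g' 1\<bar> / 2)\<close> equals \<open>e\<close>.\<close>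
    define \<kappa> where "\<kappa> = e * \<bar>g' 1\<bar> / (2 * K)"
    have "\<kappa> > 0" using that \<open>g' 1 \<noteq> 0\<close> by (simp add: \<kappa>_def)
    obtain d where "d > 0" and lin: "\<forall>\<^sub>F n in sequentially. \<forall>z\<in>?S. \<bar>z - 1\<bar> < d \<longrightarrow>
        \<bar>gn n z - gn n 1 - gn' n 1 * (z - 1)\<bar> \<le> \<kappa> * \<bar>z - 1\<bar>"
      using uniform_linearization[OF convex_real_interval(5) \<open>1 \<in> ?S\<close> \<open>\<kappa> > 0\<close> assms(8,10,11)] by blast
    have "(\<lambda>n. K * (?B n / \<bar>?A n\<bar>)) \<longlonglongrightarrow> K * 0" by (intro tendsto_mult tendsto_const ratio)
    \<comment> \<open>Below \<open>d\<close> for the linearization, below \<open>\<delta>\<close>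
      for membership in the domain.\<close>
    then have small: "\<forall>\<^sub>F n in sequentially. K * (?B n / \<bar>?A n\<bar>) < min d \<delta>"
      using \<open>d > 0\<close> \<open>\<delta> > 0\<close> by (intro order_tendstoD(2)[where y = 0]) auto
    have "(\<lambda>n. \<bar>gn' n 1\<bar>) \<longlonglongrightarrow> \<bar>g' 1\<bar>" by (intro tendsto_rabs gn'_lim)
    then have "\<forall>\<^sub>F n in sequentially. \<bar>gn' n 1\<bar> > \<bar>g' 1\<bar> / 2"
      using \<open>g' 1 \<noteq> 0\<close> by (intro order_tendstoD(1)) auto
    with lin small eventually_ge_at_top[of n0] show ?thesis
    proof (eventually_elim, intro ballI impI)
      fix n m
      assume lin: "\<forall>z\<in>?S. \<bar>z - 1\<bar> < d \<longrightarrow> \<bar>gn n z - gn n 1 - gn' n 1 * (z - 1)\<bar> \<le> \<kappa> * \<bar>z - 1\<bar>"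
        and small: "K * (?B n / \<bar>?A n\<bar>) < min d \<delta>" and "n0 \<le> n"
        and gn': "\<bar>g' 1\<bar> / 2 < \<bar>gn' n 1\<bar>" and m: "m \<in> {n0..n}" and TK: "\<bar>T n m\<bar> \<le> K"
      have A: "?A n \<noteq> 0" and B: "?B n > 0" using assms(2,3) \<open>n0 \<le> n\<close> by auto
      define z where "z = f n m / ?A n"
      have z: "z - 1 = T n m * (?B n / ?A n)" using A B by (simp add: z_def T_def field_simps)
      then have "\<bar>z - 1\<bar> = \<bar>T n m\<bar> * (?B n / \<bar>?A n\<bar>)" using B by (simp add: abs_mult)
      also have "\<dots> \<le> K * (?B n / \<bar>?A n\<bar>)" using TK B by (intro mult_right_mono) auto
      finally have zd: "\<bar>z - 1\<bar> < d" "\<bar>z - 1\<bar> < \<delta>" using small by auto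
      then have "z \<in> ?S" by (auto simp: abs_less_iff)
      then have "m \<in> ?M n" using m by (simp add: dom_set_def z_def)
      moreover have "\<bar>h n m - T n m\<bar> \<le> e"
      proof -
        have g0: "gn' n 1 \<noteq> 0" using gn' by auto
        have "h n m - T n m = (gn n z - gn n 1 - gn' n 1 * (z - 1)) / (gn' n 1 * (?B n / ?A n))"
        proof -
          have q0: "?B n / ?A n \<noteq> 0" using A B by simp
          then have "T n m = gn' n 1 * (z - 1) / (gn' n 1 * (?B n / ?A n))" unfolding z using g0 by simp
          then show ?thesis by (simp only: h_def z_def[symmetric] diff_divide_distrib)
        qed
        then have "\<bar>h n m - T n m\<bar> = \<bar>gn n z - gn n 1 - gn' n 1 * (z - 1)\<bar> / (\<bar>gn' n 1\<bar> * (?B n / \<bar>?A n\<bar>))"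
          using B by (simp add: abs_mult)
        also have "\<dots> \<le> \<kappa> * \<bar>z - 1\<bar> / (\<bar>gn' n 1\<bar> * (?B n / \<bar>?A n\<bar>))"
          using lin \<open>z \<in> ?S\<close> zd B by (intro divide_right_mono) auto
        also have "\<dots> = \<kappa> * \<bar>T n m\<bar> / \<bar>gn' n 1\<bar>"
          using A B g0 unfolding z by (simp add: abs_mult)
        also have "\<dots> \<le> \<kappa> * K / (\<bar>g' 1\<bar> / 2)"
          using TK gn' \<open>\<kappa> > 0\<close> \<open>g' 1 \<noteq> 0\<close> \<open>K > 0\<close> by (intro frac_le mult_left_mono mult_nonneg_nonneg) auto
        also have "\<dots> = e" using \<open>K > 0\<close> \<open>g' 1 \<noteq> 0\<close> by (simp add: \<kappa>_def)
        finally show ?thesis .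
      qed
      ultimately show "m \<in> ?M n \<and> \<bar>h n m - T n m\<bar> \<le> e" ..
    qed
  qed

  have close: "(\<lambda>n. unif_prob n {m. m \<notin> ?M n \<or> \<bar>h n m - T n m\<bar> > e}) \<longlonglongrightarrow> 0" if "e > 0" for e
  proof (rule order_tendstoI)
    fix \<eta> :: real assume "\<eta> > 0"
    then obtain K where K: "K > 0" "1 - Phi K + Phi (- K) < \<eta>" using Phi_tail by blast
    \<comment> \<open>This bounds the probability that m is out of range or |T| > K; its limit is
      the tail of \<open>Phi\<close>, below \<open>\<eta>\<close> by the choice of
      \<open>K\<close>.\<close>
    have "(\<lambda>n. unif_prob n ({..<n0} \<union> {n<..}) + (1 - unif_prob n {m. T n m \<le> K} + unif_prob n {m. T n m \<le> - K}))
        \<longlonglongrightarrow> 0 + (1 - Phi K + Phi (- K))"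
      by (intro tendsto_intros T unif_prob_lessThan_tendsto)
    then have "\<forall>\<^sub>F n in sequentially. unif_prob n ({..<n0} \<union> {n<..})
        + (1 - unif_prob n {m. T n m \<le> K} + unif_prob n {m. T n m \<le> - K}) < \<eta>"
      using K by (intro order_tendstoD(2)) auto
    with near[OF K(1) that]
    show "\<forall>\<^sub>F n in sequentially. unif_prob n {m. m \<notin> ?M n \<or> \<bar>h n m - T n m\<bar> > e} < \<eta>"
    proof eventually_elim
      case (elim n)
      let ?L = "{..<n0} \<union> {n<..}" and ?U = "- {m. T n m \<le> K}" and ?V = "{m. T n m \<le> - K}"
      have "{m. m \<notin> ?M n \<or> \<bar>h n m - T n m\<bar> > e} \<subseteq> ?L \<union> (?U \<union> ?V)"
      proof
        fix m assume "m \<in> {m. m \<notin> ?M n \<or> \<bar>h n m - T n m\<bar> > e}"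
        then have "\<not> (m \<in> {n0..n} \<and> \<bar>T n m\<bar> \<le> K)" using elim(1) by fastforce
        then show "m \<in> ?L \<union> (?U \<union> ?V)" by auto
      qed
      then have "unif_prob n {m. m \<notin> ?M n \<or> \<bar>h n m - T n m\<bar> > e} \<le> unif_prob n (?L \<union> (?U \<union> ?V))"
        by (rule unif_prob_mono)
      also have "\<dots> \<le> unif_prob n ?L + unif_prob n (?U \<union> ?V)" by (rule unif_prob_Un_le)
      also have "unif_prob n (?U \<union> ?V) \<le> unif_prob n ?U + unif_prob n ?V" by (rule unif_prob_Un_le)
      finally show ?case using elim(2) by (simp add: unif_prob_Compl)
    qed
  next
    fix \<eta> :: real assume "\<eta> < 0"
    moreover have "0 \<le> unif_prob n X" for n X by (simp add: unif_prob_def)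
    ultimately show "\<forall>\<^sub>F n in sequentially. \<eta> < unif_prob n {m. m \<notin> ?M n \<or> \<bar>h n m - T n m\<bar> > e}"
      by (intro always_eventually) (metis less_le_trans)
  qed

  \<comment> \<open>The event in \<open>close\<close> contains the complement of the domain for
    every tolerance; the value 1 is arbitrary.\<close>
  have "(\<lambda>n. unif_prob n (- ?M n)) \<longlonglongrightarrow> 0"
  proof (rule tendsto_sandwich[OF _ _ tendsto_const close[of 1]])
    show "\<forall>\<^sub>F n in sequentially. unif_prob n (- ?M n) \<le> unif_prob n {m. m \<notin> ?M n \<or> \<bar>h n m - T n m\<bar> > 1}"
      by (intro always_eventually allI unif_prob_mono) auto
  qed (simp_all add: unif_prob_def)
  then have "(\<lambda>n. 1 - unif_prob n (- ?M n)) \<longlonglongrightarrow> 1 - 0" by (intro tendsto_intros)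
  then have full: "(\<lambda>n. unif_prob n (?M n)) \<longlonglongrightarrow> 1" by (simp add: unif_prob_Compl)
  have "mean_A f 0 = 0"
  proof -
    have "primes_upto 0 = {}" by (auto simp: primes_upto_def)
    then show ?thesis by (simp add: mean_A_def)
  qed
  then have "n0 \<noteq> 0" using assms(2)[of 0] by auto
  then have "?M n \<subseteq> {1..n}" for n by (auto simp: dom_set_def)
  with full slutsky_unif_prob[OF T close] show ?thesis
    unfolding conv_Phi_def h_def by simp
qed

end
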